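(* Let $\mu$ be a log-concave probability measure on $\mathbb{R}^n$ with barycenter at the origin, supported on an open convex set $K\subset\mathbb{R}^n$ with density $e^{-\rho}$ on $K$, where $\rho:K\to\mathbb{R}$ is convex. Assume that $K$ is bounded, that $\rho$ is $C^\infty$-smooth, and that $\rho$ and its derivatives of all orders are bounded in $K$. Let $\psi:\mathbb{R}^n\to\mathbb{R}$ be the $C^\infty$-smooth convex function (unique up to translations) whose moment measure is $\mu$. Then for any $x\in\mathbb{R}^n$, $$\Delta\psi(x)\le 2R^2(K),$$ where $R(K)=\sup_{x\in K}|x|$ and $\Delta\psi$ is the Laplacian of $\psi$.
   Context: An absolutely continuous probability measure on $\mathbb{R}^n$ is log-concave if it is supported on an open convex set $K\subset\mathbb{R}^n$ and its density there has the form $e^{-\rho}$ with $\rho:K\to\mathbb{R}$ convex. The moment measure of a convex function $\psi:\mathbb{R}^n\to\mathbb{R}$ with $\int_{\mathbb{R}^n}e^{-\psi}=1$ is the push-forward of the probability measure $e^{-\psi(x)}dx$ under the (almost everywhere defined) map $x\mapsto\nabla\psi(x)$; i.e. $\mu$ is the moment measure of $\psi$ if $\int b\,d\mu=\int_{\mathbb{R}^n}b(\nabla\psi(x))e^{-\psi(x)}dx$ for every $\mu$-integrable $b:\mathbb{R}^n\to\mathbb{R}$. Known background: under the stated assumptions on $\mu$ there exists a convex function $\psi$ with moment measure $\mu$; it is unique up to translations, it is finite and $C^\infty$-smooth on all of $\mathbb{R}^n$, and it satisfies $e^{-\rho(\nabla\psi(x))}\det\nabla^2\psi(x)=e^{-\psi(x)}$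 for all $x\in\mathbb{R}^n$. Here $|x|$ is the Euclidean norm. *)

theory Defs
  imports "HOL-Probability.Probability"
begin

(* The value is unspecified at points where f is not differentiable. *)
definition partial_deriv :: "'n::finite \<Rightarrow> (real ^ 'n \<Rightarrow> real) \<Rightarrow> real ^ 'n \<Rightarrow> real" where
  "partial_deriv i f x = frechet_derivative f (at x) (axis i 1)"

definition iter_partial :: "'n::finite list \<Rightarrow> (real ^ 'n \<Rightarrow> real) \<Rightarrow> real ^ 'n \<Rightarrow> real" where
  "iter_partial is f = foldr partial_deriv is f"

(* Intended for open S, where it only depends on the values of f on S.  Differentiability of
   all iterated partial derivatives makes each of them continuous, so this is C^infinity. *)
definition smooth_on :: "(real ^ 'n::finite) set \<Rightarrow> (real ^ 'n \<Rightarrow> real) \<Rightarrow> bool" where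
  "smooth_on S f \<longleftrightarrow> (\<forall>is. \<forall>x\<in>S. iter_partial is f differentiable (at x))"

definition laplacian :: "(real ^ 'n::finite \<Rightarrow> real) \<Rightarrow> real ^ 'n \<Rightarrow> real" where
  "laplacian f x = (\<Sum>i\<in>UNIV. partial_deriv i (partial_deriv i f) x)"

(* The default value 0 makes the gradient of a convex function, which exists only almost
   everywhere, a Borel map on the whole space, as distr requires. *)
definition grad :: "(real ^ 'n::finite \<Rightarrow> real) \<Rightarrow> real ^ 'n \<Rightarrow> real ^ 'n" where
  "grad f x = (if f differentiable (at x) then (\<chi> i. partial_deriv i f x) else 0)"

definition log_concave_measure ::
    "(real ^ 'n::finite) measure \<Rightarrow> (real ^ 'n) set \<Rightarrow> (real ^ 'n \<Rightarrow> real) \<Rightarrow> bool" where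
  "log_concave_measure \<mu> K \<rho> \<longleftrightarrow>
     open K \<and> convex K \<and> convex_on K \<rho> \<and> prob_space \<mu> \<and>
     \<mu> = density lborel (\<lambda>x. ennreal (indicator K x * exp (- \<rho> x)))"

definition has_moment_measure ::
    "(real ^ 'n::finite \<Rightarrow> real) \<Rightarrow> (real ^ 'n) measure \<Rightarrow> bool" where
  "has_moment_measure \<psi> \<mu> \<longleftrightarrow>
     convex_on UNIV \<psi> \<and> has_bochner_integral lborel (\<lambda>x. exp (- \<psi> x)) 1 \<and>
     \<mu> = distr (density lborel (\<lambda>x. ennreal (exp (- \<psi> x)))) borel (grad \<psi>)"

end

theory Submission
  imports Defs
begin

text \<open>
Write \<open>A = D\<^sup>2\<psi>\<close>, \<open>y = \<nabla>\<psi>\<close>, and let \<open>R\<close> be the supremum of \<open>|\<cdot>|\<close> on \<open>K\<close>. The proof is a maximum principle for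
the linearization of the Monge-Ampere equation \<open>log det A = \<rho>(y) - \<psi>\<close>.

The equation is first derived from the push-forward. Where \<open>det A\<close> vanishes, \<open>\<nabla>\<psi>\<close> collapses volume, so
that set has empty interior (\<open>nondegenerate_dense\<close>); where it does not vanish, \<open>\<nabla>\<psi>\<close> is injective and
comparing the two densities on small balls gives the equation (\<open>equation_at\<close>). Since \<open>\<rho>\<close> is bounded, the
equation bounds \<open>det A\<close> below by a positive multiple of \<open>e\<^sup>-\<^sup>\<psi>\<close> on a dense set, hence everywhere;
so \<open>A\<close> is positive definite and \<open>\<nabla>\<psi>\<close> takes values in \<open>K\<close> at every point.

Fix a point \<open>x\<^sub>0\<close> and freeze the coefficients there:
\<open>L u = tr (A(x\<^sub>0)\<^sup>-\<^sup>1 D\<^sup>2u) - \<nabla>\<rho>(y(x\<^sub>0)) \<cdot> \<nabla>u\<close>. Concavity of \<open>log det\<close> and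
convexity of \<open>\<rho>\<close> together imply that \<open>L \<psi> + \<psi>\<close> is smallest at \<open>x\<^sub>0\<close> (\<open>frozen_operator_minimum\<close>). The first and
second derivative tests at this minimum yield \<open>L(\<partial>\<^sub>e\<psi>) = -\<partial>\<^sub>e\<psi>\<close> and \<open>L(\<Delta>\<psi>) \<ge> -\<Delta>\<psi>\<close> at \<open>x\<^sub>0\<close>, with no differentiation of
a determinant. As also \<open>L(|y|\<^sup>2) = 2 \<Delta>\<psi> - 2 |y|\<^sup>2\<close>, a maximum point of \<open>\<Delta>\<psi> + c |y|\<^sup>2\<close> satisfies
\<open>(2c - 1) \<Delta>\<psi> \<le> 2c |y|\<^sup>2\<close>.

This is applied with the function \<open>-G(|y|\<^sup>2)\<close>, \<open>G(r) = R\<^sup>2 + R sqrt(R\<^sup>2 - r)\<close>, in place of \<open>c |y|\<^sup>2\<close>. It is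
convex in \<open>r\<close>, so at a maximum point of \<open>\<Delta>\<psi> - G(|y|\<^sup>2)\<close> it may be replaced by its tangent line, whose slope is
the \<open>c\<close> to use; and \<open>G\<close> solves the differential equation that turns the resulting inequality into
\<open>\<Delta>\<psi> \<le> G(|y|\<^sup>2)\<close> at that point. Hence \<open>\<Delta>\<psi> \<le> G(|y|\<^sup>2) \<le> 2 R\<^sup>2\<close> everywhere (\<open>laplacian_le_2_R_sq\<close>).

The space is not compact, so \<open>\<epsilon> \<psi>\<close> is subtracted before maximizing: \<open>\<psi>\<close> has bounded sublevel sets
(\<open>bounded_sublevel\<close>) and \<open>L \<psi>\<close> is bounded above, so the penalty costs only \<open>O(\<epsilon>)\<close>. This requires \<open>\<Delta>\<psi>\<close> to be bounded
beforehand. That a priori bound comes from a two-point maximum principle for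
\<open>H(y\<^sub>1) |y\<^sub>1 - y\<^sub>2|\<^sup>2 / 2 - (\<psi>(x\<^sub>1) - \<psi>(x\<^sub>2) - y\<^sub>2 \<cdot> (x\<^sub>1 - x\<^sub>2))\<close>, a function that is bounded above simply because \<open>\<nabla>\<psi>\<close> is bounded
and \<open>\<psi>\<close> is convex, and whose nonpositivity makes \<open>\<nabla>\<psi>\<close> Lipschitz (\<open>two_point_gap\<close>, \<open>two_point_nonpos\<close>).
\<close>

section \<open>Symmetric matrices and adapted frames\<close>

text \<open>Induction on the dimension: a maximizer of the quadratic form on the unit sphere of \<open>S\<close> is an
eigenvector, and its orthogonal complement in \<open>S\<close> is again invariant.\<close>
lemma self_adjoint_eigenbasis_subspace:
  fixes f :: "'a::euclidean_space \<Rightarrow> 'a"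
  assumes lin: "linear f" and sa: "\<And>x y. f x \<bullet> y = x \<bullet> f y"
  shows "subspace S \<Longrightarrow> f ` S \<subseteq> S \<Longrightarrow>
    \<exists>B. B \<subseteq> S \<and> finite B \<and> pairwise orthogonal B \<and> (\<forall>b\<in>B. norm b = 1 \<and> (\<exists>c. f b = c *\<^sub>R b)) \<and> S \<subseteq> span B"
proof (induction "dim S" arbitrary: S rule: less_induct)
  case less
  show ?case
  proof (cases "S = {0}")
    case True
    then show ?thesis by (intro exI[of _ "{}"]) auto
  next
    case False
    let ?C = "sphere 0 1 \<inter> S"
    obtain z where z: "z \<in> S" "z \<noteq> 0" using False less.prems(1) subspace_0 by blast
    then have "z /\<^sub>R norm z \<in> ?C" using less.prems(1) by (auto simp: subspace_scale)
    then have ne: "?C \<noteq> {}" by blast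
    have comp: "compact ?C" by (intro compact_Int_closed closed_subspace less.prems) auto
    have cont: "continuous_on ?C (\<lambda>x. x \<bullet> f x)"
      by (intro continuous_intros linear_continuous_on linear_conv_bounded_linear[THEN iffD1] lin)
    obtain x where x: "x \<in> ?C" and mx: "\<And>y. y \<in> ?C \<Longrightarrow> y \<bullet> f y \<le> x \<bullet> f x"
      using continuous_attains_sup[OF comp ne cont] by blast
    have xS: "x \<in> S" and nx: "norm x = 1" using x by auto
    have xx: "x \<bullet> x = 1" using nx by (simp add: dot_square_norm)
    define l where "l = x \<bullet> f x"
    have q: "0 \<le> l * (y \<bullet> y) - y \<bullet> f y" if "y \<in> S" for y
    proof (cases "y = 0")
      case True then show ?thesis by simp
    next
      case False
      let ?u = "y /\<^sub>R norm y"
      have "?u \<in> ?C" using that False less.prems(1) by (auto simp: subspace_scale)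
      from mx[OF this] have "(y \<bullet> f y) / (norm y)\<^sup>2 \<le> l"
        by (simp add: linear_scale[OF lin] l_def field_simps power2_eq_square)
      then show ?thesis using False by (simp add: field_simps dot_square_norm)
    qed
    \<comment> \<open>The form \<open>l |y|\<^sup>2 - y \<cdot> f y\<close> is nonnegative and vanishes at \<open>x\<close>, so its linear part at \<open>x\<close> is zero.\<close>
    have ev: "f x = l *\<^sub>R x"
    proof -
      define w where "w = f x - l *\<^sub>R x"
      have wS: "w \<in> S" unfolding w_def using xS less.prems
        by (intro subspace_diff subspace_scale) auto
      have quad: "0 \<le> -2*t*(w \<bullet> w) + t\<^sup>2 * (l * (w \<bullet> w) - w \<bullet> f w)" for t :: real
      proof -
        have "x + t *\<^sub>R w \<in> S" using xS wS less.prems(1) by (intro subspace_add subspace_scale) auto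
        from q[OF this] have "0 \<le> l * (1 + 2*t*(x \<bullet> w) + t\<^sup>2 * (w \<bullet> w)) - (l + 2*t*(w \<bullet> f x) + t\<^sup>2 * (w \<bullet> f w))"
          using sa[of x w] sa[of w x]
          by (simp add: linear_add[OF lin] linear_scale[OF lin] inner_add_left inner_add_right xx l_def[symmetric]
            inner_commute algebra_simps power2_eq_square)
        moreover have "w \<bullet> f x = w \<bullet> w + l * (x \<bullet> w)"
          by (simp add: w_def inner_diff_right inner_diff_left inner_commute algebra_simps)
        ultimately show ?thesis by (simp add: algebra_simps)
      qed
      have "w \<bullet> w = 0"
      proof (rule ccontr)
        assume "w \<bullet> w \<noteq> 0"
        then have pos: "w \<bullet> w > 0" by simp
        define c where "c = l * (w \<bullet> w) - w \<bullet> f w"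
        have c0: "c \<ge> 0" unfolding c_def by (rule q[OF wS])
        define t where "t = (w \<bullet> w) / (c + 1)"
        have t: "t > 0" using pos c0 by (simp add: t_def)
        have "t * c \<le> w \<bullet> w" using c0 pos by (simp add: t_def field_simps)
        have "t * (-2 * (w \<bullet> w) + t * c) \<ge> 0" using quad[of t] by (simp add: c_def algebra_simps power2_eq_square)
        then have "-2 * (w \<bullet> w) + t * c \<ge> 0" using t by (simp add: zero_le_mult_iff)
        then show False using \<open>t * c \<le> w \<bullet> w\<close> pos by linarith
      qed
      then show ?thesis by (simp add: w_def)
    qed
    define S' where "S' = {y \<in> S. x \<bullet> y = 0}"
    have sub': "subspace S'"
      using less.prems(1) unfolding S'_def subspace_def by (auto simp: inner_add_right)
    have "x \<notin> S'" using xx by (simp add: S'_def)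
    then have "S' \<subset> S" using xS unfolding S'_def by blast
    then have dim: "dim S' < dim S"
      using sub' less.prems(1) by (metis dim_psubset span_eq_iff)
    have inv: "f ` S' \<subseteq> S'"
      using less.prems(2) sa[of x] ev unfolding S'_def by (auto simp: sa[symmetric])
    obtain B where B: "B \<subseteq> S'" "finite B" "pairwise orthogonal B"
      "\<forall>b\<in>B. norm b = 1 \<and> (\<exists>c. f b = c *\<^sub>R b)" "S' \<subseteq> span B"
      using less.hyps[OF dim sub' inv] by blast
    show ?thesis
    proof (intro exI[of _ "insert x B"] conjI)
      show "insert x B \<subseteq> S" using B(1) xS by (auto simp: S'_def)
      show "pairwise orthogonal (insert x B)"
        using B(1,3) by (auto simp: pairwise_insert S'_def orthogonal_def inner_commute)
      show "\<forall>b\<in>insert x B. norm b = 1 \<and> (\<exists>c. f b = c *\<^sub>R b)" using B(4) nx ev by auto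
      show "S \<subseteq> span (insert x B)"
      proof
        fix y assume "y \<in> S"
        then have "y - (x \<bullet> y) *\<^sub>R x \<in> S'"
          using xS less.prems(1) by (auto simp: S'_def inner_diff_right xx intro!: subspace_diff subspace_scale)
        then show "y \<in> span (insert x B)" using B(5) by (auto simp: span_insert)
      qed
    qed (use B in auto)
  qed
qed

lemma symmetric_matrix_orthonormal_eigenbasis:
  fixes M :: "real^'n^'n"
  assumes "transpose M = M"
  obtains b :: "'n \<Rightarrow> real^'n" and l :: "'n \<Rightarrow> real"
  where "\<And>i j. b i \<bullet> b j = (if i = j then 1 else 0)" "\<And>i. M *v b i = l i *\<^sub>R b i"
    "det M = (\<Prod>i\<in>UNIV. l i)" "trace M = (\<Sum>i\<in>UNIV. l i)"
proof -
  have "(M *v x) \<bullet> y = x \<bullet> (M *v y)" for x y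
    using assms by (metis dot_lmul_matrix inner_commute vector_transpose_matrix)
  from self_adjoint_eigenbasis_subspace[of "(*v) M" UNIV, OF matrix_vector_mul_linear this]
  obtain B where B: "finite B" "pairwise orthogonal B"
      "\<forall>b\<in>B. norm b = 1 \<and> (\<exists>c. M *v b = c *\<^sub>R b)" "UNIV \<subseteq> span B" by auto
  have ind: "independent B"
    using B by (intro pairwise_orthogonal_independent) auto
  have "card B = CARD('n)"
    using basis_card_eq_dim[of B UNIV] ind B(4) by simp
  then obtain b where b: "bij_betw b (UNIV::'n set) B"
    using B(1) by (metis finite_class.finite_UNIV finite_same_card_bij)
  have bB: "b i \<in> B" for i using b by (auto simp: bij_betw_def)
  have "\<forall>i. \<exists>c. M *v b i = c *\<^sub>R b i" using B(3) bB by blast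
  then obtain l where l: "\<And>i. M *v b i = l i *\<^sub>R b i" by metis
  have orth: "b i \<bullet> b j = (if i = j then 1 else 0)" for i j
  proof (cases "i = j")
    case True then show ?thesis using B(3) bB[of j] by (simp add: dot_square_norm)
  next
    case False
    then have "b i \<noteq> b j" using b by (auto simp: bij_betw_def inj_on_def)
    then show ?thesis using B(2) bB False by (auto simp: pairwise_def orthogonal_def)
  qed
  define P :: "real^'n^'n" where "P = (\<chi> i j. b j $ i)"
  have PP: "transpose P ** P = mat 1"
    by (auto simp: vec_eq_iff matrix_matrix_mult_def transpose_def P_def mat_def orth[unfolded inner_vec_def, simplified])
  have MP: "M ** P = P ** (\<chi> i j. if i = j then l i else 0)"
  proof -
    have "(M ** P) $ i $ j = (M *v b j) $ i" for i j
      by (simp add: matrix_matrix_mult_def matrix_vector_mult_def P_def)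
    then show ?thesis by (auto simp: vec_eq_iff l matrix_matrix_mult_def P_def if_distrib cong: if_cong)
  qed
  then have "det M * det P = det P * (\<Prod>i\<in>UNIV. l i)"
    using det_diagonal[of "(\<chi> i j. if i = j then l i else 0)::real^'n^'n"]
    by (simp add: det_mul[symmetric]) (simp add: det_mul)
  moreover have "det P \<noteq> 0"
    using PP by (metis det_I det_mul mult_zero_right zero_neq_one)
  ultimately have "det M = (\<Prod>i\<in>UNIV. l i)" by simp
  moreover have "trace M = (\<Sum>i\<in>UNIV. l i)"
  proof -
    have "P ** transpose P = mat 1" using PP by (simp add: matrix_left_right_inverse)
    then have "trace M = trace ((M ** P) ** transpose P)" by (simp add: matrix_mul_assoc[symmetric])
    also have "\<dots> = trace ((transpose P ** P) ** (\<chi> i j. if i = j then l i else 0))"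
      unfolding MP by (subst trace_mul_sym) (simp add: matrix_mul_assoc)
    finally show ?thesis by (simp add: PP) (simp add: trace_def)
  qed
  ultimately show ?thesis using that orth l by blast
qed

text \<open>The columns of \<open>C\<close> are an eigenbasis of \<open>A\<close> rescaled to be orthonormal for \<open>A\<close>; an orthonormal eigenbasis
of the symmetric matrix \<open>C\<^sup>T B C\<close>, mapped by \<open>C\<close>, diagonalizes both forms.\<close>
lemma simultaneous_diagonalization:
  fixes A B :: "real^'n^'n"
  assumes symA: "transpose A = A" and posA: "\<And>v. v \<noteq> 0 \<Longrightarrow> v \<bullet> (A *v v) > 0"
    and symB: "transpose B = B"
  obtains f :: "'n \<Rightarrow> real^'n" and m :: "'n \<Rightarrow> real"
  where "\<And>i j. f i \<bullet> (A *v f j) = (if i = j then 1 else 0)"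
    "\<And>i j. f i \<bullet> (B *v f j) = (if i = j then m j else 0)"
    "\<And>i. f i \<noteq> 0"
    "det B = det A * (\<Prod>i\<in>UNIV. m i)"
proof -
  obtain b :: "'n \<Rightarrow> real^'n" and l where b: "\<And>i j. b i \<bullet> b j = (if i = j then 1 else 0)"
    and l: "\<And>i. A *v b i = l i *\<^sub>R b i" and "det A = (\<Prod>i\<in>UNIV. l i)"
      and "trace A = (\<Sum>i\<in>UNIV. l i)"
    by (rule symmetric_matrix_orthonormal_eigenbasis[OF symA]) (rule that)
  have lpos: "l i > 0" for i
  proof -
    have "b i \<noteq> 0" using b[of i i] by auto
    from posA[OF this] show ?thesis by (simp add: l b)
  qed
  define C :: "real^'n^'n" where "C = (\<chi> i j. b j $ i / sqrt (l j))"
  have adj: "(C *v u) \<bullet> (X *v (C *v w)) = u \<bullet> ((transpose C ** X ** C) *v w)" for u w X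
    by (metis dot_lmul_matrix matrix_vector_mul_assoc vector_transpose_matrix transpose_transpose)
  have Cax: "C *v axis j 1 = (1 / sqrt (l j)) *\<^sub>R b j" for j
    by (simp add: vec_eq_iff C_def matrix_vector_mult_basis column_def)
  have CAC: "transpose C ** A ** C = mat 1"
  proof -
    have "(transpose C ** A ** C) $ i $ j = (mat 1 :: real^'n^'n) $ i $ j" for i j
    proof -
      have "(transpose C ** A ** C) $ i $ j = axis i 1 \<bullet> ((transpose C ** A ** C) *v axis j 1)"
        by (simp add: inner_axis' matrix_vector_mult_basis column_def)
      also have "\<dots> = (C *v axis i 1) \<bullet> (A *v (C *v axis j 1))" by (simp add: adj)
      also have "\<dots> = (if i = j then 1 else 0)"
        using lpos[of j] by (simp add: Cax matrix_vector_mult_scaleR l b)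
      finally show ?thesis by (simp add: mat_def)
    qed
    then show ?thesis by (simp add: vec_eq_iff)
  qed
  define M where "M = transpose C ** B ** C"
  have "transpose M = M" by (simp add: M_def matrix_transpose_mul symB matrix_mul_assoc)
  then obtain p :: "'n \<Rightarrow> real^'n" and m where p: "\<And>i j. p i \<bullet> p j = (if i = j then 1 else 0)"
    and m: "\<And>i. M *v p i = m i *\<^sub>R p i" and dM: "det M = (\<Prod>i\<in>UNIV. m i)"
    and "trace M = (\<Sum>i\<in>UNIV. m i)"
    by (rule symmetric_matrix_orthonormal_eigenbasis) (rule that)
  have dC: "det C * det A * det C = 1"
    using arg_cong[OF CAC, of det] by (simp add: det_mul)
  have "det M = det C * det B * det C" by (simp add: M_def det_mul)
  then have "det A * det M = det B * (det C * det A * det C)" by (simp add: algebra_simps)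
  then have dB: "det B = det A * (\<Prod>i\<in>UNIV. m i)" using dC dM by simp
  have 1: "(C *v p i) \<bullet> (A *v (C *v p j)) = (if i = j then 1 else 0)" for i j
    by (simp add: adj CAC p)
  have 2: "(C *v p i) \<bullet> (B *v (C *v p j)) = (if i = j then m j else 0)" for i j
    by (simp add: adj M_def[symmetric] m p)
  have 3: "C *v p i \<noteq> 0" for i using 1[of i i] by auto
  show thesis by (rule that[OF 1 2 3 dB])
qed

text \<open>An \<open>A\<close>-orthonormal frame with matrix \<open>F\<close> satisfies \<open>F\<^sup>T A F = 1\<close>, hence also \<open>A F F\<^sup>T = 1\<close>; thus
\<open>A\<close> is the sum of the rank-one forms given by the vectors \<open>A f\<^sub>i\<close>.\<close>
lemma frame_expansion:
  fixes A :: "real^'n^'n" and f :: "'n \<Rightarrow> real^'n"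
  assumes f: "\<And>i j. f i \<bullet> (A *v f j) = (if i = j then 1 else 0)"
    and sym: "transpose A = A"
  shows "A *v w = (\<Sum>i\<in>UNIV. ((A *v f i) \<bullet> w) *\<^sub>R (A *v f i))"
proof -
  define F :: "real^'n^'n" where "F = (\<chi> i j. f j $ i)"
  have FAF: "transpose F ** (A ** F) = mat 1"
  proof -
    have "(A ** F) $ k $ j = (A *v f j) $ k" for k j
      by (simp add: matrix_matrix_mult_def matrix_vector_mult_def F_def)
    then have "(transpose F ** (A ** F)) $ i $ j = f i \<bullet> (A *v f j)" for i j
      by (simp add: matrix_matrix_mult_def[of "transpose F"] inner_vec_def) (simp add: transpose_def F_def)
    then show ?thesis by (simp add: vec_eq_iff f mat_def)
  qed
  then have "A ** F ** transpose F = mat 1" by (simp add: matrix_left_right_inverse)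
  then have "A *v w = (A ** F ** transpose F) *v (A *v w)" by simp
  also have "\<dots> = A *v (F *v (transpose F *v (A *v w)))"
    by (simp add: matrix_vector_mul_assoc matrix_mul_assoc)
  also have "F *v (transpose F *v (A *v w)) = (\<Sum>i\<in>UNIV. ((A *v f i) \<bullet> w) *\<^sub>R f i)"
  proof -
    have "(transpose F *v (A *v w)) $ i = (A *v f i) \<bullet> w" for i
    proof -
      have "(transpose F *v (A *v w)) $ i = f i \<bullet> (A *v w)"
        by (simp add: vector_matrix_mult_def F_def inner_vec_def mult.commute)
      also have "\<dots> = (A *v f i) \<bullet> w"
        using sym by (metis dot_lmul_matrix vector_transpose_matrix)
      finally show ?thesis .
    qed
    then have "F *v (transpose F *v (A *v w)) = F *v (\<chi> i. (A *v f i) \<bullet> w)"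
      by (intro arg_cong[where f="(*v) F"]) (simp only: vec_eq_iff vec_lambda_beta, blast)
    then show ?thesis
      by (simp add: vec_eq_iff) (simp add: matrix_vector_mult_def F_def mult.commute)
  qed
  also have "A *v \<dots> = (\<Sum>i\<in>UNIV. ((A *v f i) \<bullet> w) *\<^sub>R (A *v f i))"
    by (simp add: linear_sum[OF matrix_vector_mul_linear] matrix_vector_mult_scaleR)
  finally show ?thesis .
qed

text \<open>Concavity of \<open>log det\<close> at \<open>A\<close>: the sum on the right is \<open>tr (A\<^sup>-\<^sup>1 B)\<close>. In terms of the eigenvalues of
\<open>B\<close> relative to \<open>A\<close> it is the inequality \<open>ln m \<le> m - 1\<close>.\<close>
lemma frame_trace_ge_ln_det:
  fixes A B :: "real^'n^'n" and f :: "'n \<Rightarrow> real^'n"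
  assumes f: "\<And>i j. f i \<bullet> (A *v f j) = (if i = j then 1 else 0)" and dA: "det A > 0"
    and symB: "transpose B = B" and posB: "\<And>v. v \<noteq> 0 \<Longrightarrow> v \<bullet> (B *v v) > 0"
  shows "real CARD('n) + ln (det B) - ln (det A) \<le> (\<Sum>i\<in>UNIV. f i \<bullet> (B *v f i))"
proof -
  define F :: "real^'n^'n" where "F = (\<chi> i j. f j $ i)"
  have ent: "(transpose F ** (X ** F)) $ i $ j = f i \<bullet> (X *v f j)" for X i j
  proof -
    have "(X ** F) $ k $ j = (X *v f j) $ k" for k j
      by (simp add: matrix_matrix_mult_def matrix_vector_mult_def F_def)
    then show ?thesis
      by (simp add: matrix_matrix_mult_def[of "transpose F"] inner_vec_def) (simp add: transpose_def F_def)
  qed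
  define M where "M = transpose F ** (B ** F)"
  have FAF: "transpose F ** (A ** F) = mat 1" by (simp add: vec_eq_iff ent f mat_def)
  have "transpose M = M" by (simp add: M_def matrix_transpose_mul symB matrix_mul_assoc)
  then obtain p :: "'n \<Rightarrow> real^'n" and m where p: "\<And>i j. p i \<bullet> p j = (if i = j then 1 else 0)"
    and m: "\<And>i. M *v p i = m i *\<^sub>R p i" and dM: "det M = (\<Prod>i\<in>UNIV. m i)"
    and tM: "trace M = (\<Sum>i\<in>UNIV. m i)"
    by (rule symmetric_matrix_orthonormal_eigenbasis) (rule that)
  have mpos: "m i > 0" for i
  proof -
    have "F *v p i \<noteq> 0"
    proof
      assume "F *v p i = 0"
      then have "mat 1 *v p i = 0"
        unfolding FAF[symmetric] by (simp add: matrix_vector_mul_assoc[symmetric])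
      then show False using p[of i i] by simp
    qed
    from posB[OF this] have "0 < p i \<bullet> (M *v p i)"
      unfolding M_def by (metis dot_lmul_matrix matrix_vector_mul_assoc vector_transpose_matrix transpose_transpose)
    then show ?thesis by (simp add: m p)
  qed
  have "det F * det A * det F = 1" using arg_cong[OF FAF, of det] by (simp add: det_mul)
  moreover have "det M = det F * det B * det F" by (simp add: M_def det_mul)
  ultimately have "det A * det M = det B * 1" by (metis mult.assoc mult.commute)
  then have dB: "det B = det A * (\<Prod>i\<in>UNIV. m i)" by (simp add: dM)
  have "ln (det B) - ln (det A) = (\<Sum>i\<in>UNIV. ln (m i))"
    unfolding dB using dA mpos by (simp add: ln_mult prod_pos ln_prod less_imp_neq[symmetric])
  also have "\<dots> \<le> (\<Sum>i\<in>UNIV. m i - 1)"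
    using mpos by (intro sum_mono ln_le_minus_one)
  also have "\<dots> = trace M - real CARD('n)" by (simp add: sum_subtractf tM)
  also have "trace M = (\<Sum>i\<in>UNIV. f i \<bullet> (B *v f i))" by (simp add: trace_def M_def ent)
  finally show ?thesis by simp
qed

section \<open>Directional derivatives of smooth functions\<close>

definition dir_deriv :: "real^'n \<Rightarrow> (real^'n \<Rightarrow> real) \<Rightarrow> real^'n \<Rightarrow> real" where
  "dir_deriv v f x = (\<Sum>i\<in>UNIV. v $ i * partial_deriv i f x)"

abbreviation smooth :: "(real^'n \<Rightarrow> real) \<Rightarrow> bool" where
  "smooth \<equiv> smooth_on UNIV"

lemma smooth_differentiable: "smooth f \<Longrightarrow> f differentiable (at x)"
  unfolding smooth_on_def iter_partial_def by (drule spec[of _ "[]"]) auto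

lemma differentiable_has_derivative_dir_deriv:
  assumes "f differentiable (at x)"
  shows "(f has_derivative (\<lambda>v. dir_deriv v f x)) (at x)"
proof -
  let ?D = "frechet_derivative f (at x)"
  have D: "(f has_derivative ?D) (at x)" using assms by (simp add: frechet_derivative_works)
  then have lin: "linear ?D" by (rule has_derivative_linear)
  have "?D v = dir_deriv v f x" for v
  proof -
    have "?D v = ?D (\<Sum>i\<in>UNIV. v $ i *\<^sub>R axis i 1)"
      using basis_expansion[of v] by (simp add: scalar_mult_eq_scaleR)
    also have "\<dots> = (\<Sum>i\<in>UNIV. v $ i *\<^sub>R ?D (axis i 1))"
      by (simp add: linear_sum[OF lin] linear_scale[OF lin])
    finally show ?thesis by (simp add: dir_deriv_def partial_deriv_def)
  qed
  then have "?D = (\<lambda>v. dir_deriv v f x)" by blast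
  with D show ?thesis by simp
qed

lemma smooth_has_derivative:
  "smooth f \<Longrightarrow> (f has_derivative (\<lambda>v. dir_deriv v f x)) (at x)"
  by (intro differentiable_has_derivative_dir_deriv smooth_differentiable)

lemma dir_deriv_axis [simp]: "dir_deriv (axis i 1) f = partial_deriv i f"
  by (rule ext) (simp add: dir_deriv_def axis_def if_distrib if_distribR cong: if_cong)

lemma partial_deriv_eqI:
  "(f has_derivative f') (at x) \<Longrightarrow> partial_deriv i f x = f' (axis i 1)"
  by (simp add: partial_deriv_def frechet_derivative_at[symmetric])

lemma smooth_partial_deriv: "smooth f \<Longrightarrow> smooth (partial_deriv i f)"
proof -
  assume f: "smooth f"
  have "iter_partial is (partial_deriv i f) = iter_partial (is @ [i]) f" for "is"
    by (simp add: iter_partial_def)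
  then show ?thesis using f by (simp add: smooth_on_def)
qed

lemma partial_deriv_add:
  assumes "f differentiable (at x)" "g differentiable (at x)"
  shows "partial_deriv i (\<lambda>x. f x + g x) x = partial_deriv i f x + partial_deriv i g x"
  using partial_deriv_eqI[OF has_derivative_add[OF assms[THEN differentiable_has_derivative_dir_deriv]]]
  by simp

lemma partial_deriv_cmult:
  assumes "f differentiable (at x)"
  shows "partial_deriv i (\<lambda>x. c * f x) x = c * partial_deriv i f x"
  using partial_deriv_eqI[OF has_derivative_mult_right[OF assms[THEN differentiable_has_derivative_dir_deriv], of c]]
  by simp

lemma smooth_iterD: "smooth f \<Longrightarrow> iter_partial is f differentiable (at x)"
  by (simp add: smooth_on_def)

lemma iter_partial_Cons [simp]: "iter_partial (i # is) f = partial_deriv i (iter_partial is f)"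
  and iter_partial_Nil [simp]: "iter_partial [] f = f"
  by (simp_all add: iter_partial_def)

lemma smooth_add:
  assumes "smooth f" "smooth g" shows "smooth (\<lambda>x. f x + g x)"
proof -
  have "iter_partial is (\<lambda>x. f x + g x) = (\<lambda>x. iter_partial is f x + iter_partial is g x)" for "is"
    by (induction "is") (auto simp: partial_deriv_add smooth_iterD assms)
  then show ?thesis using assms by (simp add: smooth_on_def)
qed

lemma smooth_cmult:
  assumes "smooth f" shows "smooth (\<lambda>x. c * f x)"
proof -
  have "iter_partial is (\<lambda>x. c * f x) = (\<lambda>x. c * iter_partial is f x)" for "is"
    by (induction "is") (auto simp: partial_deriv_cmult smooth_iterD assms)
  then show ?thesis using assms by (simp add: smooth_on_def)
qed

lemma smooth_const: "smooth (\<lambda>x::real^'n. c)"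
proof -
  have p: "partial_deriv i (\<lambda>x. k) = (\<lambda>x::real^'n. 0)" for i and k :: real
    by (rule ext) (simp add: partial_deriv_eqI[OF has_derivative_const])
  have "\<exists>k. iter_partial is (\<lambda>x::real^'n. c) = (\<lambda>x. k)" for "is"
    by (induction "is") (auto simp: p)
  then have "iter_partial is (\<lambda>x::real^'n. c) differentiable (at x)" for "is" x
    by (metis differentiable_const)
  then show ?thesis by (simp add: smooth_on_def)
qed

lemma smooth_sum:
  assumes "\<And>i. i \<in> I \<Longrightarrow> smooth (f i)" shows "smooth (\<lambda>x. \<Sum>i\<in>I. f i x)"
  using assms by (induction I rule: infinite_finite_induct) (auto intro: smooth_const smooth_add)

lemma smooth_dir_deriv: "smooth f \<Longrightarrow> smooth (dir_deriv v f)"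
  unfolding dir_deriv_def[abs_def]
  by (intro smooth_sum smooth_cmult smooth_partial_deriv)

lemma dir_deriv_add:
  assumes "smooth f" "smooth g"
  shows "dir_deriv v (\<lambda>x. f x + g x) = (\<lambda>x. dir_deriv v f x + dir_deriv v g x)"
  by (rule ext)
    (simp add: dir_deriv_def partial_deriv_add smooth_differentiable assms distrib_left sum.distrib)

lemma dir_deriv_sum:
  fixes f :: "'i \<Rightarrow> real^'n \<Rightarrow> real"
  assumes "\<And>i. i \<in> I \<Longrightarrow> smooth (f i)" "finite I"
  shows "dir_deriv v (\<lambda>x. \<Sum>i\<in>I. f i x) = (\<lambda>x. \<Sum>i\<in>I. dir_deriv v (f i) x)"
  using assms(2,1)
proof (induction I)
  case empty
  have "partial_deriv i (\<lambda>x. 0) = (\<lambda>x::real^'n. 0::real)" for i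
    by (rule ext) (simp add: partial_deriv_eqI[OF has_derivative_const])
  then show ?case by (auto simp: dir_deriv_def)
qed (simp add: dir_deriv_add smooth_sum)

lemma smooth_continuous: "smooth f \<Longrightarrow> continuous_on S f"
  by (meson continuous_at_imp_continuous_on differentiable_imp_continuous_within smooth_differentiable)

lemma smooth_line_deriv:
  assumes "smooth f"
  shows "((\<lambda>t. f (x + t *\<^sub>R v)) has_real_derivative dir_deriv v f (x + t *\<^sub>R v)) (at t)"
proof -
  have lin: "linear (\<lambda>w. dir_deriv w f (x + t *\<^sub>R v))"
    using smooth_has_derivative[OF assms] by (rule has_derivative_linear)
  have "((\<lambda>t. x + t *\<^sub>R v) has_derivative (\<lambda>s. s *\<^sub>R v)) (at t)"
    by (auto intro!: derivative_eq_intros)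
  from has_derivative_compose[OF this smooth_has_derivative[OF assms]]
  show ?thesis
    by (simp add: has_field_derivative_def linear_scale[OF lin] mult.commute[of _ "dir_deriv v f (x + t *\<^sub>R v)"])
qed

text \<open>The mean value theorem applied in the direction \<open>u\<close> and then in the direction \<open>v\<close>. The left-hand side is
symmetric in \<open>u\<close> and \<open>v\<close>, which forces mixed derivatives to commute.\<close>
lemma second_difference_mean_value:
  assumes f: "smooth f" and h: "h > 0"
  obtains a b where "0 < a" "a < h" "0 < b" "b < h"
    "f (x + h *\<^sub>R u + h *\<^sub>R v) - f (x + h *\<^sub>R u) - f (x + h *\<^sub>R v) + f x
      = h * h * dir_deriv v (dir_deriv u f) (x + a *\<^sub>R u + b *\<^sub>R v)"
proof -
  have d: "((\<lambda>s. f (x + s *\<^sub>R u + h *\<^sub>R v) - f (x + s *\<^sub>R u)) has_real_derivative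
      dir_deriv u f (x + s *\<^sub>R u + h *\<^sub>R v) - dir_deriv u f (x + s *\<^sub>R u)) (at s)" for s
    using DERIV_diff[OF smooth_line_deriv[OF f, of "x + h *\<^sub>R v" u s] smooth_line_deriv[OF f, of x u s]]
    by (simp add: algebra_simps)
  obtain a where a: "0 < a" "a < h" and
    ea: "f (x + h *\<^sub>R u + h *\<^sub>R v) - f (x + h *\<^sub>R u) - (f (x + 0 *\<^sub>R u + h *\<^sub>R v) - f (x + 0 *\<^sub>R u))
      = (h - 0) * (dir_deriv u f (x + a *\<^sub>R u + h *\<^sub>R v) - dir_deriv u f (x + a *\<^sub>R u))"
    using MVT2[OF h, of "\<lambda>s. f (x + s *\<^sub>R u + h *\<^sub>R v) - f (x + s *\<^sub>R u)"
      "\<lambda>s. dir_deriv u f (x + s *\<^sub>R u + h *\<^sub>R v) - dir_deriv u f (x + s *\<^sub>R u)"] d by blast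
  obtain b where b: "0 < b" "b < h" and
    eb: "dir_deriv u f (x + a *\<^sub>R u + h *\<^sub>R v) - dir_deriv u f (x + a *\<^sub>R u + 0 *\<^sub>R v)
      = (h - 0) * dir_deriv v (dir_deriv u f) (x + a *\<^sub>R u + b *\<^sub>R v)"
    using MVT2[OF h, of "\<lambda>t. dir_deriv u f (x + a *\<^sub>R u + t *\<^sub>R v)"
      "\<lambda>t. dir_deriv v (dir_deriv u f) (x + a *\<^sub>R u + t *\<^sub>R v)"]
      smooth_line_deriv[OF smooth_dir_deriv[OF f]] by blast
  show thesis
    by (rule that[OF a b]) (use ea eb in \<open>simp add: algebra_simps\<close>)
qed

lemma dir_deriv_commute:
  assumes f: "smooth f"
  shows "dir_deriv u (dir_deriv v f) = dir_deriv v (dir_deriv u f)"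
proof (rule ext, rule ccontr)
  fix x
  let ?g = "dir_deriv u (dir_deriv v f)" and ?k = "dir_deriv v (dir_deriv u f)"
  assume ne: "?g x \<noteq> ?k x"
  define e where "e = \<bar>?g x - ?k x\<bar> / 2"
  have e: "e > 0" using ne by (simp add: e_def)
  have "continuous (at x) ?g" "continuous (at x) ?k"
    using f by (auto intro!: differentiable_imp_continuous_within smooth_differentiable smooth_dir_deriv)
  then obtain r1 r2 where r: "r1 > 0" "\<And>z. dist z x < r1 \<Longrightarrow> dist (?g z) (?g x) < e"
    "r2 > 0" "\<And>z. dist z x < r2 \<Longrightarrow> dist (?k z) (?k x) < e"
    using e unfolding continuous_at_eps_delta by metis
  define h where "h = min r1 r2 / (norm u + norm v + 1)"
  have nuv: "norm u + norm v + 1 > 0" by (smt (verit) norm_ge_zero)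
  then have h: "h > 0" using r by (simp add: h_def)
  have small: "dist (x + a *\<^sub>R u + b *\<^sub>R v) x < min r1 r2" if "0 < a" "a < h" "0 < b" "b < h" for a b
  proof -
    have "dist (x + a *\<^sub>R u + b *\<^sub>R v) x = norm (a *\<^sub>R u + b *\<^sub>R v)" by (simp add: dist_norm algebra_simps)
    also have "\<dots> \<le> a * norm u + b * norm v" using that norm_triangle_ineq[of "a *\<^sub>R u" "b *\<^sub>R v"] by simp
    also have "\<dots> \<le> h * norm u + h * norm v" using that by (intro add_mono mult_right_mono) auto
    also have "\<dots> < h * (norm u + norm v + 1)" using h by (simp add: algebra_simps)
    also have "\<dots> = min r1 r2" using nuv by (simp add: h_def)
    finally show ?thesis .
  qed
  obtain a b where ab: "0 < a" "a < h" "0 < b" "b < h" and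
    1: "f (x + h *\<^sub>R u + h *\<^sub>R v) - f (x + h *\<^sub>R u) - f (x + h *\<^sub>R v) + f x = h * h * ?k (x + a *\<^sub>R u + b *\<^sub>R v)"
    using second_difference_mean_value[OF f h] by metis
  obtain c d where cd: "0 < c" "c < h" "0 < d" "d < h" and
    2: "f (x + h *\<^sub>R v + h *\<^sub>R u) - f (x + h *\<^sub>R v) - f (x + h *\<^sub>R u) + f x = h * h * ?g (x + c *\<^sub>R v + d *\<^sub>R u)"
    using second_difference_mean_value[OF f h] by metis
  have "h * h * ?k (x + a *\<^sub>R u + b *\<^sub>R v) = h * h * ?g (x + c *\<^sub>R v + d *\<^sub>R u)"
    using 1 2 by (simp add: algebra_simps)
  then have "?k (x + a *\<^sub>R u + b *\<^sub>R v) = ?g (x + d *\<^sub>R u + c *\<^sub>R v)" using h by (simp add: algebra_simps)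
  moreover have "dist (?k (x + a *\<^sub>R u + b *\<^sub>R v)) (?k x) < e" using small[OF ab] r by simp
  moreover have "dist (?g (x + d *\<^sub>R u + c *\<^sub>R v)) (?g x) < e"
    using small[OF cd(3,4,1,2)] r by simp
  ultimately show False unfolding e_def dist_real_def by (smt (verit) field_sum_of_halves)
qed

definition hess :: "(real^'n \<Rightarrow> real) \<Rightarrow> real^'n \<Rightarrow> real^'n^'n" where
  "hess f x = (\<chi> i j. partial_deriv j (partial_deriv i f) x)"

lemma grad_inner: "f differentiable (at x) \<Longrightarrow> grad f x \<bullet> v = dir_deriv v f x"
  by (simp add: grad_def inner_vec_def dir_deriv_def mult.commute)

lemma smooth_grad_nth: "smooth f \<Longrightarrow> grad f x $ i = partial_deriv i f x"
  by (simp add: grad_def smooth_differentiable)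

lemma hess_mult_nth: "(hess f x *v w) $ i = dir_deriv w (partial_deriv i f) x"
  by (simp add: hess_def matrix_vector_mult_def dir_deriv_def mult.commute)

lemma inner_hess:
  assumes f: "smooth f"
  shows "v \<bullet> (hess f x *v w) = dir_deriv v (dir_deriv w f) x"
proof -
  have "v \<bullet> (hess f x *v w) = (\<Sum>i\<in>UNIV. v $ i * dir_deriv w (partial_deriv i f) x)"
    by (simp add: inner_vec_def hess_mult_nth)
  also have "\<dots> = (\<Sum>i\<in>UNIV. v $ i * partial_deriv i (dir_deriv w f) x)"
    using dir_deriv_commute[OF f, of w "axis i 1" for i] by simp
  finally show ?thesis by (simp add: dir_deriv_def[of v])
qed

lemma hess_inner:
  assumes f: "smooth f"
  shows "(hess f x *v w) \<bullet> v = dir_deriv v (dir_deriv w f) x"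
  using inner_hess[OF f] by (simp add: inner_commute)

lemma transpose_hess:
  assumes f: "smooth f" shows "transpose (hess f x) = hess f x"
  using dir_deriv_commute[OF f, of "axis i 1" "axis j 1" for i j]
  by (simp add: hess_def transpose_def vec_eq_iff)

lemma has_vector_derivative_vecI:
  fixes F :: "real \<Rightarrow> real^'n"
  assumes "\<And>i. ((\<lambda>t. F t $ i) has_real_derivative D $ i) (at t)"
  shows "(F has_vector_derivative D) (at t)"
  unfolding has_vector_derivative_def
proof (subst has_derivative_componentwise_within, intro ballI)
  fix b :: "real^'n" assume "b \<in> Basis"
  then obtain i where b: "b = axis i 1" by (auto simp: Basis_vec_def)
  show "((\<lambda>x. F x \<bullet> b) has_derivative (\<lambda>x. x *\<^sub>R D \<bullet> b)) (at t)"
    using assms[of i] by (simp add: b inner_axis has_field_derivative_def mult_commute_abs)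
qed

lemma grad_line_deriv:
  assumes f: "smooth f"
  shows "((\<lambda>t. grad f (x + t *\<^sub>R v)) has_vector_derivative (hess f (x + t *\<^sub>R v) *v v)) (at t)"
  by (rule has_vector_derivative_vecI)
    (use smooth_line_deriv[OF smooth_partial_deriv[OF f]] in \<open>simp add: smooth_grad_nth[OF f] hess_mult_nth\<close>)

text \<open>The derivative of \<open>t \<mapsto> D\<^sup>2f(x + t v) v\<close>, that is, the second derivative of the gradient along \<open>v\<close>.\<close>
definition third_deriv :: "(real^'n \<Rightarrow> real) \<Rightarrow> real^'n \<Rightarrow> real^'n \<Rightarrow> real^'n" where
  "third_deriv f v x = (\<chi> i. dir_deriv v (dir_deriv v (partial_deriv i f)) x)"

lemma hess_line_deriv:
  assumes f: "smooth f"
  shows "((\<lambda>t. hess f (x + t *\<^sub>R v) *v v) has_vector_derivative third_deriv f v (x + t *\<^sub>R v)) (at t)"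
  by (rule has_vector_derivative_vecI)
    (use smooth_line_deriv[OF smooth_dir_deriv[OF smooth_partial_deriv[OF f]]] in \<open>simp add: third_deriv_def hess_mult_nth\<close>)

lemma third_deriv_inner:
  assumes f: "smooth f"
  shows "third_deriv f v x \<bullet> w = dir_deriv w (dir_deriv v (dir_deriv v f)) x"
proof -
  have "dir_deriv v (dir_deriv v (partial_deriv i f)) = partial_deriv i (dir_deriv v (dir_deriv v f))" for i
    using dir_deriv_commute[OF f, of v "axis i 1"] dir_deriv_commute[OF smooth_dir_deriv[OF f], of v "axis i 1" v]
    by simp
  then show ?thesis
    by (simp add: inner_vec_def third_deriv_def dir_deriv_def[of w] mult.commute)
qed

lemma grad_has_derivative:
  fixes f :: "real^'n \<Rightarrow> real"
  assumes f: "smooth f"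
  shows "(grad f has_derivative ((*v) (hess f x))) (at x)"
proof (subst has_derivative_componentwise_within, intro ballI)
  fix b :: "real^'n" assume "b \<in> Basis"
  then obtain i where b: "b = axis i 1" by (auto simp: Basis_vec_def)
  show "((\<lambda>x. grad f x \<bullet> b) has_derivative (\<lambda>v. (hess f x *v v) \<bullet> b)) (at x)"
    using smooth_has_derivative[OF smooth_partial_deriv[OF f]]
    by (simp add: b inner_axis smooth_grad_nth[OF f] hess_mult_nth)
qed

lemma continuous_on_grad: "smooth f \<Longrightarrow> continuous_on S (grad f)"
  using grad_has_derivative by (meson continuous_at_imp_continuous_on has_derivative_continuous)

lemma continuous_on_det_hess: "smooth f \<Longrightarrow> continuous_on S (\<lambda>x. det (hess f x))"
  unfolding det_def hess_def
  by (simp, intro continuous_intros smooth_continuous smooth_partial_deriv)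

lemma laplacian_eq_trace: "laplacian f x = (\<Sum>i\<in>UNIV. dir_deriv (axis i 1) (dir_deriv (axis i 1) f) x)"
  by (simp add: laplacian_def)

lemma second_derivative_pos_increase:
  fixes p p' :: "real \<Rightarrow> real"
  assumes d: "\<And>t. (p has_real_derivative p' t) (at t)" and d2: "(p' has_real_derivative p2) (at 0)"
    and "p' 0 = 0" "p2 > 0" "r > 0"
  obtains s where "0 < s" "s < r" "p 0 < p s"
proof -
  obtain e where e: "e > 0" "\<And>h. 0 < h \<Longrightarrow> h < e \<Longrightarrow> p' 0 < p' (0 + h)"
    using DERIV_pos_inc_right[OF d2] assms by auto
  define s where "s = min e r / 2"
  have s: "0 < s" "s < e" "s < r" using e(1) assms by (auto simp: s_def)
  obtain c where c: "0 < c" "c < s" "p s - p 0 = (s - 0) * p' c"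
    using MVT2[of 0 s p p'] d s(1) by auto
  have "p' c > 0" using e(2)[of c] c s assms by simp
  then have "(s - 0) * p' c > 0" using s by simp
  then have "p 0 < p s" using c(3) by linarith
  with s that show thesis by blast
qed

lemma second_derivative_test_max:
  fixes p p' :: "real \<Rightarrow> real"
  assumes d: "\<And>t. (p has_real_derivative p' t) (at t)" and d2: "(p' has_real_derivative p2) (at 0)"
    and mx: "\<And>t. p t \<le> p 0"
  shows "p' 0 = 0" "p2 \<le> 0"
proof -
  show z: "p' 0 = 0" by (rule DERIV_local_max[OF d, of 1]) (use mx in auto)
  show "p2 \<le> 0"
  proof (rule ccontr)
    assume "\<not> p2 \<le> 0"
    then obtain s where "p 0 < p s"
      using second_derivative_pos_increase[OF d d2 z, of 1] by auto
    then show False using mx[of s] by simp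
  qed
qed

lemma smooth_min_derivatives:
  assumes f: "smooth f" and mn: "\<And>z. f x \<le> f z"
  shows "dir_deriv v f x = 0" "0 \<le> dir_deriv v (dir_deriv v f) x"
proof -
  have d: "((\<lambda>t. - f (x + t *\<^sub>R v)) has_real_derivative - dir_deriv v f (x + t *\<^sub>R v)) (at t)" for t
    by (rule DERIV_minus[OF smooth_line_deriv[OF f]])
  have d2: "((\<lambda>t. - dir_deriv v f (x + t *\<^sub>R v)) has_real_derivative - dir_deriv v (dir_deriv v f) x) (at 0)"
    using DERIV_minus[OF smooth_line_deriv[OF smooth_dir_deriv[OF f, of v], of x v 0]] by simp
  show "dir_deriv v f x = 0" "0 \<le> dir_deriv v (dir_deriv v f) x"
    using second_derivative_test_max[of "\<lambda>t. - f (x + t *\<^sub>R v)", OF d d2] mn by auto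
qed

section \<open>Volumes of images, over an arbitrary finite index type\<close>

lemma swapidseq_conj:
  assumes s: "bij (s :: 'm \<Rightarrow> 'n)"
  shows "swapidseq k p \<Longrightarrow> swapidseq k (s \<circ> p \<circ> inv s)"
proof (induction k p rule: swapidseq.induct)
  case id
  have "s \<circ> id \<circ> inv s = id" using s by (simp add: bij_is_surj surj_iff[symmetric])
  then show ?case by (simp only: swapidseq.id)
next
  case (comp_Suc k p a b)
  have "s \<circ> (Transposition.transpose a b \<circ> p) \<circ> inv s = Transposition.transpose (s a) (s b) \<circ> (s \<circ> p \<circ> inv s)"
    using s by (auto simp: fun_eq_iff Transposition.transpose_def bij_def inj_eq)
  moreover have "s a \<noteq> s b" using comp_Suc s by (simp add: bij_def inj_eq)
  ultimately show ?case using swapidseq.comp_Suc[OF comp_Suc.IH] by metis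
qed

lemma sign_conj:
  assumes s: "bij (s :: 'm::finite \<Rightarrow> 'n)" and p: "p permutes UNIV"
  shows "sign (s \<circ> p \<circ> inv s) = sign p"
proof -
  have "permutation p" using p by (rule permutes_imp_permutation[OF finite])
  then obtain k where k: "swapidseq k p" unfolding permutation_def by blast
  show ?thesis
    using evenperm_unique[OF k refl] evenperm_unique[OF swapidseq_conj[OF s k] refl]
    by (simp add: sign_def)
qed

lemma det_reindex:
  fixes A :: "real^'n^'n" and s :: "'m::finite \<Rightarrow> 'n"
  assumes s: "bij s"
  shows "det (\<chi> i j. A $ s i $ s j) = det A"
proof -
  have is_: "inv s (s x) = x" "s (inv s y) = y" for x y
    using s by (simp_all add: bij_is_inj bij_is_surj surj_f_inv_f)
  have "det (\<chi> i j. A $ s i $ s j) =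
      (\<Sum>p | p permutes UNIV. of_int (sign p) * (\<Prod>i\<in>UNIV. A $ s i $ s (p i)))"
    by (simp add: det_def)
  also have "\<dots> = (\<Sum>p | p permutes UNIV. of_int (sign p) * (\<Prod>i\<in>UNIV. A $ i $ p i))"
  proof (rule sum.reindex_bij_witness[where i = "\<lambda>p. inv s \<circ> p \<circ> s" and j = "\<lambda>p. s \<circ> p \<circ> inv s"])
    fix p :: "'m \<Rightarrow> 'm" assume p: "p \<in> {p. p permutes UNIV}"
    then have bp: "bij p" by (simp add: permutes_imp_bij)
    show "inv s \<circ> (s \<circ> p \<circ> inv s) \<circ> s = p" by (simp add: fun_eq_iff is_)
    show "s \<circ> p \<circ> inv s \<in> {p. p permutes UNIV}"
      using bp s by (auto intro!: bij_imp_permutes bij_comp bij_imp_bij_inv)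
    have "(\<Prod>i\<in>UNIV. A $ i $ (s \<circ> p \<circ> inv s) i) = (\<Prod>i\<in>UNIV. A $ s i $ s (p i))"
      by (rule prod.reindex_bij_witness[where i = s and j = "inv s"]) (auto simp: is_)
    then show "of_int (sign (s \<circ> p \<circ> inv s)) * (\<Prod>i\<in>UNIV. A $ i $ (s \<circ> p \<circ> inv s) i)
       = of_int (sign p) * (\<Prod>i\<in>UNIV. A $ s i $ s (p i))"
      using sign_conj[OF s] p by simp
  next
    fix p :: "'n \<Rightarrow> 'n" assume p: "p \<in> {p. p permutes UNIV}"
    then have bp: "bij p" by (simp add: permutes_imp_bij)
    show "s \<circ> (inv s \<circ> p \<circ> s) \<circ> inv s = p" by (simp add: fun_eq_iff is_)
    show "inv s \<circ> p \<circ> s \<in> {p. p permutes UNIV}"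
      using bp s by (auto intro!: bij_imp_permutes bij_comp bij_imp_bij_inv)
  qed
  finally show ?thesis by (simp add: det_def)
qed

lemma prod_Basis_cart: "(\<Prod>b\<in>(Basis :: (real^'n) set). h b) = (\<Prod>i\<in>UNIV. h (axis i 1))"
proof -
  have "(Basis :: (real^'n) set) = range (\<lambda>i. axis i 1)" by (auto simp: Basis_vec_def)
  moreover have "inj (\<lambda>i::'n. axis i (1::real))" by (auto simp: inj_def axis_eq_axis)
  ultimately show ?thesis using prod.reindex[of "\<lambda>i::'n. axis i (1::real)" UNIV h] by (simp add: comp_def)
qed

text \<open>Renaming coordinates along a bijection preserves volume and determinants. This carries volume estimates for images,
whose usual proofs order the coordinates, over to an arbitrary finite index type.\<close>
lemma lborel_reindex:
  fixes s :: "'m::finite \<Rightarrow> 'n::finite"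
  assumes s: "bij s"
  shows "distr lborel borel (\<lambda>x::real^'m. \<chi> i. x $ inv s i) = (lborel :: (real^'n) measure)"
proof (rule lborel_eqI[symmetric])
  let ?U = "\<lambda>x::real^'m. (\<chi> i. x $ inv s i) :: real^'n"
  have is_: "inv s (s x) = x" "s (inv s y) = y" for x y
    using s by (simp_all add: bij_is_inj bij_is_surj surj_f_inv_f)
  have U: "?U \<in> borel_measurable borel"
    by (intro borel_measurable_continuous_onI continuous_intros)
  fix l u :: "real^'n" assume le: "\<And>b. b \<in> Basis \<Longrightarrow> l \<bullet> b \<le> u \<bullet> b"
  let ?l = "(\<chi> j. l $ s j) :: real^'m" and ?u = "(\<chi> j. u $ s j) :: real^'m"
  have "?U -` box l u = box ?l ?u"
    by (auto simp: mem_box_cart) (metis is_(1), metis is_(1), metis is_(2), metis is_(2))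
  then have "emeasure (distr lborel borel ?U) (box l u) = emeasure lborel (box ?l ?u)"
    using U by (simp add: emeasure_distr)
  also have "\<dots> = (\<Prod>b\<in>Basis. (?u - ?l) \<bullet> b)"
  proof (rule emeasure_lborel_box)
    fix b :: "real^'m" assume "b \<in> Basis"
    then obtain j where "b = axis j 1" by (auto simp: Basis_vec_def)
    then show "?l \<bullet> b \<le> ?u \<bullet> b" using le[of "axis (s j) 1"] by (simp add: inner_axis)
  qed
  also have "(\<Prod>b\<in>Basis. (?u - ?l) \<bullet> b) = (\<Prod>b\<in>Basis. (u - l) \<bullet> b)"
    unfolding prod_Basis_cart
    by (rule prod.reindex_bij_witness[where j = s and i = "inv s"]) (auto simp: is_ inner_axis)
  finally show "emeasure (distr lborel borel ?U) (box l u) = (\<Prod>b\<in>Basis. (u - l) \<bullet> b)" .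
qed auto

lemma measure_lebesgue_compact: "compact S \<Longrightarrow> measure lebesgue S = measure lborel (S :: 'a::euclidean_space set)"
  by (simp add: measure_completion compact_imp_closed)

lemma image_measure_bounds_wellorder:
  fixes g :: "real^'m::{finite,wellorder} \<Rightarrow> real^'m::_"
  assumes S: "compact S" and g: "\<And>x. x \<in> S \<Longrightarrow> (g has_derivative ((*v) (G x))) (at x)"
    and cont: "continuous_on S (\<lambda>x. det (G x))"
  shows "(\<And>x. x \<in> S \<Longrightarrow> \<bar>det (G x)\<bar> \<le> c) \<Longrightarrow> measure lborel (g ` S) \<le> c * measure lborel S"
    and "(\<And>x. x \<in> S \<Longrightarrow> c \<le> \<bar>det (G x)\<bar>) \<Longrightarrow> inj_on g S \<Longrightarrow> c * measure lborel S \<le> measure lborel (g ` S)"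
proof -
  have meas: "S \<in> lmeasurable" using S by (rule lmeasurable_compact)
  have "continuous_on S g" using g by (meson continuous_at_imp_continuous_on has_derivative_continuous)
  then have gS: "compact (g ` S)" using S by (rule compact_continuous_image)
  have "integrable lborel (\<lambda>x. indicator S x *\<^sub>R \<bar>det (G x)\<bar>)"
    using S cont by (intro borel_integrable_compact continuous_intros)
  then have "(\<lambda>x. indicator S x *\<^sub>R \<bar>det (G x)\<bar>) integrable_on UNIV"
    by (rule integrable_on_lborel)
  moreover have "(\<lambda>x. indicator S x *\<^sub>R \<bar>det (G x)\<bar>) = (\<lambda>x. if x \<in> S then \<bar>det (G x)\<bar> else 0)"
    by (auto simp: indicator_def)
  ultimately have int: "(\<lambda>x. \<bar>det (G x)\<bar>) integrable_on S"
    by (simp add: integrable_restrict_UNIV)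
  have g': "(g has_derivative ((*v) (G x))) (at x within S)" if "x \<in> S" for x
    using g[OF that] by (rule has_derivative_at_withinI)
  show "measure lborel (g ` S) \<le> c * measure lborel S" if "\<And>x. x \<in> S \<Longrightarrow> \<bar>det (G x)\<bar> \<le> c"
    using measure_bounded_differentiable_image[OF meas g', of c] int that
    by (simp add: measure_lebesgue_compact S gS)
  show "c * measure lborel S \<le> measure lborel (g ` S)"
    if c: "\<And>x. x \<in> S \<Longrightarrow> c \<le> \<bar>det (G x)\<bar>" and inj: "inj_on g S"
  proof -
    have "measure lebesgue (g ` S) = integral S (\<lambda>x. \<bar>det (G x)\<bar>)"
      using measure_differentiable_image_eq[OF _ g' inj] meas int by (simp add: fmeasurableD)
    moreover have "integral S (\<lambda>x. c * 1) \<le> integral S (\<lambda>x. \<bar>det (G x)\<bar>)"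
      using c int meas by (intro integral_le integrable_on_mult_right) (auto simp: lmeasurable_iff_integrable_on)
    moreover have "integral S (\<lambda>x. c * 1) = c * measure lebesgue S"
      unfolding lmeasure_integral[OF meas] by (rule integral_mult_right)
    ultimately show ?thesis by (simp only: measure_lebesgue_compact S gS)
  qed
qed

text \<open>The bounds of the preceding lemma for \<open>g\<close> on \<open>real^'n\<close>, applied to the conjugate of \<open>g\<close> by the renaming of coordinates \<open>T\<close>.\<close>
lemma image_measure_bounds_reindexed:
  fixes g :: "real^'n \<Rightarrow> real^'n" and s :: "'m::{finite,wellorder} \<Rightarrow> 'n"
  assumes s: "bij s"
    and S: "compact S" and g: "\<And>x. x \<in> S \<Longrightarrow> (g has_derivative ((*v) (G x))) (at x)"
    and cont: "continuous_on S (\<lambda>x. det (G x))"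
  shows "(\<And>x. x \<in> S \<Longrightarrow> \<bar>det (G x)\<bar> \<le> c) \<Longrightarrow> measure lborel (g ` S) \<le> c * measure lborel S"
    and "(\<And>x. x \<in> S \<Longrightarrow> c \<le> \<bar>det (G x)\<bar>) \<Longrightarrow> inj_on g S \<Longrightarrow> c * measure lborel S \<le> measure lborel (g ` S)"
proof -
  have is_: "inv s (s x) = x" "s (inv s y) = y" for x y
    using s by (simp_all add: bij_is_inj bij_is_surj surj_f_inv_f)
  define U where "U = (\<lambda>x::real^'m::_. (\<chi> i. x $ inv s i) :: real^'n)"
  define T where "T = (\<lambda>x::real^'n. (\<chi> i. x $ s i) :: real^'m::_)"
  have UT: "U (T x) = x" "T (U y) = y" for x y by (simp_all add: U_def T_def vec_eq_iff is_)
  have contU: "continuous_on X U" and contT: "continuous_on Y T" for X Y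
    unfolding U_def T_def by (intro continuous_intros)+
  have meas: "measure lborel (T ` X) = measure lborel X" if X: "compact X" for X
  proof -
    have "T ` X = U -` X" using UT by (auto intro: image_eqI[where x = "U _"])
    have U: "U \<in> borel_measurable borel" by (intro borel_measurable_continuous_onI contU)
    have "measure lborel X = measure (distr lborel borel U) X"
      using lborel_reindex[OF s] by (simp add: U_def)
    also have "\<dots> = measure lborel (U -` X)"
      using U X by (subst measure_distr) (auto simp: compact_imp_closed)
    finally show ?thesis using \<open>T ` X = U -` X\<close> by simp
  qed
  have linU: "linear U" "linear T" unfolding U_def T_def by (auto intro!: linearI simp: vec_eq_iff)
  have dU: "(U has_derivative U) F" "(T has_derivative T) F'" for F F'
    using linU by (simp_all add: linear_imp_has_derivative)
  define h where "h = T \<circ> g \<circ> U"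
  define H where "H x = (\<chi> i j. G (U x) $ s i $ s j)" for x
  have detH: "det (H x) = det (G (U x))" for x unfolding H_def by (rule det_reindex[OF s])
  have hT: "h ` (T ` S) = T ` (g ` S)" by (auto simp: h_def UT image_comp)
  have TS: "compact (T ` S)" using S contT by (intro compact_continuous_image)
  have "continuous_on S g" using g by (meson continuous_at_imp_continuous_on has_derivative_continuous)
  then have gS: "compact (g ` S)" using S by (rule compact_continuous_image)
  have h: "(h has_derivative ((*v) (H x))) (at x)" if x: "x \<in> T ` S" for x
  proof -
    have "U x \<in> S" using x UT by auto
    from diff_chain_at[OF diff_chain_at[OF dU(1)[of "at x"] g[OF this]] dU(2)]
    have "(h has_derivative (T \<circ> ((*v) (G (U x)) \<circ> U))) (at x)" by (simp add: h_def comp_assoc)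
    moreover have "(T \<circ> ((*v) (G (U x)) \<circ> U)) v = H x *v v" for v
    proof -
      have "(\<Sum>j\<in>UNIV. G (U x) $ s i $ j * v $ inv s j) = (\<Sum>j\<in>UNIV. G (U x) $ s i $ s j * v $ j)" for i
        by (rule sum.reindex_bij_witness[where j = "inv s" and i = "s"]) (auto simp: is_)
      then show ?thesis by (simp add: vec_eq_iff matrix_vector_mult_def H_def T_def) (simp add: U_def)
    qed
    then have "T \<circ> ((*v) (G (U x)) \<circ> U) = (*v) (H x)" by blast
    ultimately show ?thesis by metis
  qed
  have "continuous_on (T ` S) (\<lambda>x. det (G (U x)))"
    by (rule continuous_on_compose2[OF cont contU]) (auto simp: UT)
  then have contH: "continuous_on (T ` S) (\<lambda>x. det (H x))" by (simp add: detH)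
  note bounds = image_measure_bounds_wellorder[OF TS h contH, unfolded hT meas[OF S] meas[OF gS]]
  show "measure lborel (g ` S) \<le> c * measure lborel S" if "\<And>x. x \<in> S \<Longrightarrow> \<bar>det (G x)\<bar> \<le> c"
    using that by (intro bounds(1)) (auto simp: detH UT)
  show "c * measure lborel S \<le> measure lborel (g ` S)"
    if c: "\<And>x. x \<in> S \<Longrightarrow> c \<le> \<bar>det (G x)\<bar>" and inj: "inj_on g S"
  proof (rule bounds(2))
    show "inj_on h (T ` S)"
    proof (rule inj_onI)
      fix a b assume ab: "a \<in> T ` S" "b \<in> T ` S" "h a = h b"
      then have "g (U a) = g (U b)" by (metis UT(1) comp_apply h_def)
      moreover have "U a \<in> S" "U b \<in> S" using ab UT by auto
      ultimately have "U a = U b" using inj by (simp add: inj_on_def)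
      then show "a = b" by (metis UT(2))
    qed
  qed (use c in \<open>auto simp: detH UT\<close>)
qed

text \<open>Every finite type is in bijection with one that carries a well-order, pulled back along an arbitrary
injection into the natural numbers.\<close>
typedef 'a wellordered_copy = "UNIV :: 'a set" by auto

definition finite_index :: "'a::finite \<Rightarrow> nat" where
  "finite_index = (SOME f. inj f)"

lemma inj_finite_index: "inj finite_index"
proof -
  have "\<exists>f :: 'a \<Rightarrow> nat. inj f"
    using finite_imp_inj_to_nat_seg[OF finite_class.finite_UNIV] by metis
  then show ?thesis unfolding finite_index_def by (rule someI_ex)
qed

instantiation wellordered_copy :: (finite) "{finite, wellorder}"
begin

definition less_eq_wellordered_copy :: "'a wellordered_copy \<Rightarrow> 'a wellordered_copy \<Rightarrow> bool" where
  "x \<le> y \<longleftrightarrow> finite_index (Rep_wellordered_copy x) \<le> finite_index (Rep_wellordered_copy y)"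

definition less_wellordered_copy :: "'a wellordered_copy \<Rightarrow> 'a wellordered_copy \<Rightarrow> bool" where
  "x < y \<longleftrightarrow> finite_index (Rep_wellordered_copy x) < finite_index (Rep_wellordered_copy y)"

instance
proof
  show "finite (UNIV :: 'a wellordered_copy set)"
    using finite_imageI[OF finite_class.finite_UNIV, of "Abs_wellordered_copy :: 'a \<Rightarrow> _"]
      type_definition.Abs_image[OF type_definition_wellordered_copy] by metis
next
  fix x y :: "'a wellordered_copy"
  assume "x \<le> y" "y \<le> x"
  then have "finite_index (Rep_wellordered_copy x) = finite_index (Rep_wellordered_copy y)"
    by (simp add: less_eq_wellordered_copy_def)
  then have "Rep_wellordered_copy x = Rep_wellordered_copy y"
    by (rule injD[OF inj_finite_index])
  then show "x = y" by (simp add: Rep_wellordered_copy_inject)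
next
  fix P :: "'a wellordered_copy \<Rightarrow> bool" and a :: "'a wellordered_copy"
  assume step: "\<And>x. (\<And>y. y < x \<Longrightarrow> P y) \<Longrightarrow> P x"
  show "P a"
    by (induction "finite_index (Rep_wellordered_copy a)" arbitrary: a rule: less_induct)
      (metis step less_wellordered_copy_def)
qed (auto simp: less_eq_wellordered_copy_def less_wellordered_copy_def)

end

lemma bij_Rep_wellordered_copy: "bij (Rep_wellordered_copy :: 'a::finite wellordered_copy \<Rightarrow> 'a)"
  by (intro bij_betwI'[of UNIV _ UNIV, simplified])
    (auto simp: Rep_wellordered_copy_inject intro: Abs_wellordered_copy_inverse[symmetric])

lemmas image_measure_bounds = image_measure_bounds_reindexed[OF bij_Rep_wellordered_copy]

section \<open>The Monge-Ampere equation of a moment map\<close>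

lemma psd_nonsingular_imp_pos_def:
  fixes M :: "real^'n^'n"
  assumes sym: "transpose M = M" and psd: "\<And>v. 0 \<le> v \<bullet> (M *v v)" and det: "det M \<noteq> 0"
  shows "0 < det M" "v \<noteq> 0 \<Longrightarrow> 0 < v \<bullet> (M *v v)"
proof -
  obtain b :: "'n \<Rightarrow> real^'n" and l where b: "\<And>i j. b i \<bullet> b j = (if i = j then 1 else 0)"
    and l: "\<And>i. M *v b i = l i *\<^sub>R b i" and d: "det M = (\<Prod>i\<in>UNIV. l i)"
    and "trace M = (\<Sum>i\<in>UNIV. l i)"
    by (rule symmetric_matrix_orthonormal_eigenbasis[OF sym]) (rule that)
  have "l i \<noteq> 0" for i using det d by (auto simp: prod_zero_iff)
  moreover have "l i \<ge> 0" for i using psd[of "b i"] by (simp add: l b)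
  ultimately have lpos: "l i > 0" for i by (simp add: less_le)
  then show "0 < det M" by (simp add: d prod_pos)
  have exp: "w = (\<Sum>i\<in>UNIV. (b i \<bullet> w) *\<^sub>R b i)" for w
  proof -
    have "mat 1 *v w = (\<Sum>i\<in>UNIV. ((mat 1 *v b i) \<bullet> w) *\<^sub>R (mat 1 *v b i))"
      by (rule frame_expansion) (simp_all add: b)
    then show ?thesis by (simp only: matrix_vector_mul_lid)
  qed
  show "0 < v \<bullet> (M *v v)" if "v \<noteq> 0"
  proof -
    obtain k where k: "b k \<bullet> v \<noteq> 0"
    proof -
      have "v = 0" if "\<And>k. b k \<bullet> v = 0"
        by (subst exp) (simp add: that)
      then show ?thesis using \<open>v \<noteq> 0\<close> that by blast
    qed
    have "M *v v = M *v (\<Sum>i\<in>UNIV. (b i \<bullet> v) *\<^sub>R b i)" by (rule arg_cong[OF exp])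
    also have "\<dots> = (\<Sum>i\<in>UNIV. (b i \<bullet> v) *\<^sub>R (l i *\<^sub>R b i))"
      by (simp add: linear_sum[OF matrix_vector_mul_linear] matrix_vector_mult_scaleR l)
    finally have Mv: "M *v v = (\<Sum>i\<in>UNIV. (b i \<bullet> v) *\<^sub>R (l i *\<^sub>R b i))" .
    have "v \<bullet> (M *v v) = (\<Sum>i\<in>UNIV. l i * (b i \<bullet> v)\<^sup>2)"
      unfolding Mv by (simp add: inner_sum_right power2_eq_square inner_commute mult_ac)
    also have "\<dots> > 0"
      using k lpos by (intro sum_pos2[of _ k]) (auto simp: less_imp_le)
    finally show ?thesis .
  qed
qed

text \<open>Otherwise \<open>f\<close> would rise, just after leaving \<open>x\<close>, above the chord from \<open>x\<close> to \<open>z\<close>.\<close>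
lemma convex_on_above_tangent:
  assumes f: "convex_on S f" and x: "x \<in> S" and z: "z \<in> S" and d: "f differentiable (at x)"
  shows "f x + dir_deriv (z - x) f x \<le> f z"
proof (rule ccontr)
  assume "\<not> ?thesis"
  then have D: "dir_deriv (z - x) f x - (f z - f x) > 0" by simp
  have lin: "linear (\<lambda>w. dir_deriv w f x)"
    using differentiable_has_derivative_dir_deriv[OF d] by (rule has_derivative_linear)
  have "((\<lambda>t. x + t *\<^sub>R (z - x)) has_derivative (\<lambda>s. s *\<^sub>R (z - x))) (at 0)"
    by (auto intro!: derivative_eq_intros)
  from has_derivative_compose[OF this, of f "\<lambda>w. dir_deriv w f x"] differentiable_has_derivative_dir_deriv[OF d]
  have "((\<lambda>t. f (x + t *\<^sub>R (z - x))) has_real_derivative dir_deriv (z - x) f x) (at 0)"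
    by (simp add: has_field_derivative_def linear_scale[OF lin] mult.commute[of _ "dir_deriv (z - x) f x"])
  then have "((\<lambda>t. f (x + t *\<^sub>R (z - x)) - t * (f z - f x)) has_real_derivative
      dir_deriv (z - x) f x - (f z - f x)) (at 0)"
    by (auto intro!: derivative_eq_intros)
  from DERIV_pos_inc_right[OF this D] obtain e where e: "e > 0" and
    inc: "\<And>h. 0 < h \<Longrightarrow> h < e \<Longrightarrow> f x < f (x + h *\<^sub>R (z - x)) - h * (f z - f x)"
    by auto
  define h where "h = min e 1 / 2"
  have h: "0 < h" "h < e" "h < 1" using e by (auto simp: h_def)
  have "f ((1 - h) *\<^sub>R x + h *\<^sub>R z) \<le> (1 - h) * f x + h * f z"
    using f h x z by (intro convex_onD) auto
  moreover have "(1 - h) *\<^sub>R x + h *\<^sub>R z = x + h *\<^sub>R (z - x)" by (simp add: algebra_simps)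
  ultimately show False using inc[OF h(1,2)] by (simp add: algebra_simps)
qed

lemma convex_smooth_psd:
  assumes f: "convex_on UNIV f" "smooth f"
  shows "0 \<le> v \<bullet> (hess f x *v v)"
proof -
  let ?p = "\<lambda>t. t * dir_deriv v f x - f (x + t *\<^sub>R v)"
  have d: "(?p has_real_derivative dir_deriv v f x - dir_deriv v f (x + t *\<^sub>R v)) (at t)" for t
    by (auto intro!: derivative_eq_intros smooth_line_deriv[OF f(2)])
  have "((\<lambda>t. dir_deriv v f (x + t *\<^sub>R v)) has_real_derivative dir_deriv v (dir_deriv v f) x) (at 0)"
    using smooth_line_deriv[OF smooth_dir_deriv[OF f(2), of v], of x v 0] by simp
  then have d2: "((\<lambda>t. dir_deriv v f x - dir_deriv v f (x + t *\<^sub>R v)) has_real_derivative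
      - dir_deriv v (dir_deriv v f) x) (at 0)"
    by (auto intro!: derivative_eq_intros)
  have lin: "linear (\<lambda>w. dir_deriv w f x)"
    using smooth_has_derivative[OF f(2)] by (rule has_derivative_linear)
  have "?p t \<le> ?p 0" for t
    using convex_on_above_tangent[OF f(1), of x "x + t *\<^sub>R v"] smooth_differentiable[OF f(2)]
    by (simp add: linear_scale[OF lin])
  from second_derivative_test_max(2)[OF d d2 this] show ?thesis by (simp add: inner_hess[OF f(2)])
qed

text \<open>If the gradients at \<open>x\<close> and \<open>y\<close> agree, the tangent inequalities at both ends make \<open>f\<close> affine on the segment between
them, against the positive second derivative at \<open>x\<close>.\<close>
lemma convex_grad_inj:
  assumes f: "convex_on UNIV f" "smooth f"
    and pos: "\<And>v. v \<noteq> 0 \<Longrightarrow> 0 < v \<bullet> (hess f x *v v)" and eq: "grad f y = grad f x"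
  shows "y = x"
proof (rule ccontr)
  assume "y \<noteq> x"
  define v where "v = y - x"
  have v: "v \<noteq> 0" using \<open>y \<noteq> x\<close> by (simp add: v_def)
  have sd: "f differentiable (at z)" for z by (rule smooth_differentiable[OF f(2)])
  have gr: "dir_deriv w f z = grad f z \<bullet> w" for w z by (simp add: grad_inner sd)
  have "f x + grad f x \<bullet> v \<le> f y" "f y - grad f x \<bullet> v \<le> f x"
    using convex_on_above_tangent[OF f(1), of x y] convex_on_above_tangent[OF f(1), of y x] sd eq
    by (simp_all add: gr v_def inner_diff_right)
  then have fy: "f y = f x + grad f x \<bullet> v" by simp
  let ?p = "\<lambda>t. f (x + t *\<^sub>R v) - t * (grad f x \<bullet> v)"
  have d: "(?p has_real_derivative dir_deriv v f (x + t *\<^sub>R v) - grad f x \<bullet> v) (at t)" for t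
    by (auto intro!: derivative_eq_intros smooth_line_deriv[OF f(2)])
  have "((\<lambda>t. dir_deriv v f (x + t *\<^sub>R v)) has_real_derivative dir_deriv v (dir_deriv v f) x) (at 0)"
    using smooth_line_deriv[OF smooth_dir_deriv[OF f(2), of v], of x v 0] by simp
  then have d2: "((\<lambda>t. dir_deriv v f (x + t *\<^sub>R v) - grad f x \<bullet> v) has_real_derivative
      dir_deriv v (dir_deriv v f) x) (at 0)"
    by (auto intro!: derivative_eq_intros)
  obtain s where s: "0 < s" "s < 1" "?p 0 < ?p s"
    by (rule second_derivative_pos_increase[OF d d2, of 1])
      (use pos[OF v] in \<open>auto simp: inner_hess[OF f(2)] gr\<close>)
  have "f ((1 - s) *\<^sub>R x + s *\<^sub>R y) \<le> (1 - s) * f x + s * f y"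
    using f s by (intro convex_onD) auto
  moreover have "(1 - s) *\<^sub>R x + s *\<^sub>R y = x + s *\<^sub>R v" by (simp add: v_def algebra_simps)
  ultimately show False using s(3) by (simp add: fy algebra_simps)
qed

text \<open>The consequences of the push-forward: the Hessian of \<open>\<psi>\<close> is nondegenerate, the gradient stays in \<open>K\<close>, the
Monge-Ampere equation holds, and \<open>\<psi>\<close> grows at infinity.\<close>
locale moment_map =
  fixes \<mu> :: "(real^'n) measure" and K :: "(real^'n) set" and \<rho> \<psi> :: "real^'n \<Rightarrow> real"
  assumes lc: "log_concave_measure \<mu> K \<rho>" and bdK: "bounded K"
    and diff_rho: "\<And>y. y \<in> K \<Longrightarrow> \<rho> differentiable (at y)"
    and bd_rho: "bounded (\<rho> ` K)"
    and smooth_psi: "smooth \<psi>" and mm: "has_moment_measure \<psi> \<mu>"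
begin

lemma K: "open K" "convex K" "convex_on K \<rho>"
  and prob: "prob_space \<mu>" and mu_dens: "\<mu> = density lborel (\<lambda>x. ennreal (indicator K x * exp (- \<rho> x)))"
  using lc by (auto simp: log_concave_measure_def)

lemma convex_psi: "convex_on UNIV \<psi>" and int_psi: "has_bochner_integral lborel (\<lambda>x. exp (- \<psi> x)) 1"
  and mu_distr: "\<mu> = distr (density lborel (\<lambda>x. ennreal (exp (- \<psi> x)))) borel (grad \<psi>)"
  using mm by (auto simp: has_moment_measure_def)

lemma cont_rho: "continuous_on K \<rho>"
  using diff_rho by (meson continuous_at_imp_continuous_on differentiable_imp_continuous_within)

lemma meas_grad [measurable]: "grad \<psi> \<in> borel_measurable borel"
  by (intro borel_measurable_continuous_onI continuous_on_grad smooth_psi)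

lemma meas_psi [measurable]: "\<psi> \<in> borel_measurable borel"
  by (intro borel_measurable_continuous_onI smooth_continuous smooth_psi)

lemma meas_rho [measurable]: "(\<lambda>x. indicator K x * exp (- \<rho> x)) \<in> borel_measurable borel"
proof -
  have "(\<lambda>x. indicator K x *\<^sub>R exp (- \<rho> x)) \<in> borel_measurable borel"
    using K(1) by (intro borel_measurable_continuous_on_indicator continuous_intros cont_rho) auto
  then show ?thesis by simp
qed

lemma pushforward:
  assumes X [measurable]: "X \<in> sets borel"
  shows "(\<integral>\<^sup>+x. ennreal (exp (- \<psi> x)) * indicator (grad \<psi> -` X) x \<partial>lborel) =
    (\<integral>\<^sup>+y. ennreal (indicator K y * exp (- \<rho> y)) * indicator X y \<partial>lborel)"
proof -
  have "grad \<psi> -` X \<in> sets lborel" using measurable_sets[OF meas_grad X] by simp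
  then have "emeasure \<mu> X = (\<integral>\<^sup>+x. ennreal (exp (- \<psi> x)) * indicator (grad \<psi> -` X) x \<partial>lborel)"
    unfolding mu_distr by (subst emeasure_distr) (auto simp: emeasure_density)
  moreover have "emeasure \<mu> X = (\<integral>\<^sup>+y. ennreal (indicator K y * exp (- \<rho> y)) * indicator X y \<partial>lborel)"
    unfolding mu_dens by (subst emeasure_density) auto
  ultimately show ?thesis by simp
qed

text \<open>A nonempty open set has positive mass for \<open>e\<^sup>-\<^sup>\<psi>\<close>, so its image cannot lie in a set that is null for \<open>\<mu>\<close>.\<close>
lemma null_image_avoided:
  assumes X: "X \<in> sets borel" and null: "X \<inter> K \<in> null_sets lborel" and V: "open V" "V \<noteq> {}"
  shows "\<exists>x\<in>V. grad \<psi> x \<notin> X"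
proof (rule ccontr)
  assume "\<not> ?thesis"
  then have sub: "V \<subseteq> grad \<psi> -` X" by auto
  have vX: "grad \<psi> -` X \<in> sets borel" using measurable_sets[OF meas_grad X] by simp
  have "AE y in lborel. y \<notin> X \<inter> K" using null by (rule AE_not_in)
  then have "AE y in lborel. ennreal (indicator K y * exp (- \<rho> y)) * indicator X y = 0"
    by eventually_elim (auto simp: indicator_def)
  then have "(\<integral>\<^sup>+y. ennreal (indicator K y * exp (- \<rho> y)) * indicator X y \<partial>lborel) = 0"
    using X by (subst nn_integral_0_iff_AE) auto
  then have "(\<integral>\<^sup>+x. ennreal (exp (- \<psi> x)) * indicator (grad \<psi> -` X) x \<partial>lborel) = 0"
    using pushforward[OF X] by simp
  then have "AE x in lborel. ennreal (exp (- \<psi> x)) * indicator (grad \<psi> -` X) x = 0"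
    using vX by (subst (asm) nn_integral_0_iff_AE) auto
  then have "AE x in lborel. x \<notin> V"
    by eventually_elim (use sub in \<open>auto simp: indicator_def split: if_splits\<close>)
  then have "V \<in> null_sets lborel"
    using V AE_iff_null_sets[of V lborel] by simp
  then have "negligible V" by (simp add: negligible_iff_null_sets null_sets_completionI)
  then show False using open_not_negligible[OF V] by simp
qed

lemma psd: "0 \<le> v \<bullet> (hess \<psi> x *v v)"
  by (rule convex_smooth_psd[OF convex_psi smooth_psi])

lemma pos_def_if: "det (hess \<psi> x) \<noteq> 0 \<Longrightarrow> 0 < det (hess \<psi> x)"
  "det (hess \<psi> x) \<noteq> 0 \<Longrightarrow> v \<noteq> 0 \<Longrightarrow> 0 < v \<bullet> (hess \<psi> x *v v)"
  using psd_nonsingular_imp_pos_def[OF transpose_hess[OF smooth_psi] psd] by blast+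

lemma grad_inj: "det (hess \<psi> x) \<noteq> 0 \<Longrightarrow> grad \<psi> y = grad \<psi> x \<Longrightarrow> y = x"
  by (rule convex_grad_inj[OF convex_psi smooth_psi]) (auto intro: pos_def_if)

text \<open>On a ball where the Hessian is singular the gradient would have an image of volume zero, which
\<open>null_image_avoided\<close> excludes.\<close>
lemma nondegenerate_dense:
  assumes V: "open V" "V \<noteq> {}"
  shows "\<exists>x\<in>V. grad \<psi> x \<in> K \<and> det (hess \<psi> x) \<noteq> 0"
proof (rule ccontr)
  assume neg: "\<not> ?thesis"
  have "\<exists>x\<in>V. grad \<psi> x \<notin> - K"
    using K(1) by (intro null_image_avoided V) auto
  then obtain z where z: "z \<in> V" "grad \<psi> z \<in> K" by auto
  have "open (V \<inter> grad \<psi> -` K)"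
    using V(1) K(1) continuous_on_grad[OF smooth_psi, of UNIV]
    by (intro open_Int) (auto simp: continuous_on_open_vimage)
  then obtain r where r: "r > 0" "cball z r \<subseteq> V \<inter> grad \<psi> -` K"
    using z unfolding open_contains_cball by blast
  let ?C = "cball z r"
  have "det (hess \<psi> x) = 0" if "x \<in> ?C" for x using neg subsetD[OF r(2) that] by blast
  then have "measure lborel (grad \<psi> ` ?C) \<le> 0 * measure lborel ?C"
    using grad_has_derivative[OF smooth_psi]
    by (intro image_measure_bounds(1)[where G = "hess \<psi>"] continuous_on_det_hess smooth_psi) auto
  then have "measure lborel (grad \<psi> ` ?C) = 0" using measure_nonneg[of lborel "grad \<psi> ` ?C"] by linarith
  moreover have comp: "compact (grad \<psi> ` ?C)"
    by (intro compact_continuous_image continuous_on_grad smooth_psi) auto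
  ultimately have "grad \<psi> ` ?C \<in> null_sets lborel"
    using emeasure_compact_finite[OF comp] by (auto simp: emeasure_eq_ennreal_measure null_sets_def compact_imp_closed)
  moreover have "grad \<psi> ` ?C \<inter> K = grad \<psi> ` ?C" using r by auto
  ultimately have "\<exists>x\<in>ball z r. grad \<psi> x \<notin> grad \<psi> ` ?C"
    using r(1) comp by (intro null_image_avoided) (auto simp: compact_imp_closed)
  then show False by auto
qed

text \<open>The gradient is injective over the ball \<open>C\<close>, so the push-forward equates the mass of \<open>C\<close> for \<open>e\<^sup>-\<^sup>\<psi>\<close> with the mass of its image
for \<open>e\<^sup>-\<^sup>\<rho>\<close>; bounding both masses by extreme values of the densities and the volume of the image by extreme
values of the determinant leaves the volume of \<open>C\<close> as a common factor.\<close>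
lemma ball_comparison:
  assumes r: "r > 0" and C: "\<And>z. z \<in> cball x r \<Longrightarrow> grad \<psi> z \<in> K \<and> det (hess \<psi> z) \<noteq> 0"
    and F: "\<And>z. z \<in> cball x r \<Longrightarrow> a \<le> exp (- \<psi> z) \<and> exp (- \<psi> z) \<le> a'"
    and E: "\<And>z. z \<in> cball x r \<Longrightarrow> e \<le> exp (- \<rho> (grad \<psi> z)) \<and> exp (- \<rho> (grad \<psi> z)) \<le> e'"
    and D: "\<And>z. z \<in> cball x r \<Longrightarrow> d \<le> det (hess \<psi> z) \<and> det (hess \<psi> z) \<le> d'"
    and nonneg: "0 \<le> a" "0 \<le> e"
  shows "a \<le> e' * d'" "e * d \<le> a'"
proof -
  let ?C = "cball x r" and ?X = "grad \<psi> ` cball x r"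
  have comp: "compact ?X"
    by (intro compact_continuous_image continuous_on_grad smooth_psi) auto
  have [measurable]: "?X \<in> sets borel" "?C \<in> sets borel" using comp by (auto simp: compact_imp_closed)
  have inj: "inj_on (grad \<psi>) ?C" using grad_inj C by (auto simp: inj_on_def)
  have pre: "grad \<psi> -` ?X = ?C" using grad_inj C by blast
  define c where "c = measure lborel ?C"
  define m where "m = measure lborel ?X"
  have ec: "emeasure lborel ?C = ennreal c" and em: "emeasure lborel ?X = ennreal m"
    using emeasure_compact_finite[of ?C] emeasure_compact_finite[OF comp]
    by (auto simp: c_def m_def emeasure_eq_ennreal_measure)
  have c: "c > 0" using r content_cball_pos by (simp add: c_def)
  have m0: "m \<ge> 0" by (simp add: m_def)
  have "0 < det (hess \<psi> z)" if "z \<in> ?C" for z using C[OF that] by (intro pos_def_if) auto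
  then have bnd: "m \<le> d' * c" "d * c \<le> m"
    unfolding m_def c_def using D grad_has_derivative[OF smooth_psi]
    by (intro image_measure_bounds[where G = "hess \<psi>"] continuous_on_det_hess smooth_psi inj; force)+
  have eq: "(\<integral>\<^sup>+x. ennreal (exp (- \<psi> x)) * indicator ?C x \<partial>lborel) =
    (\<integral>\<^sup>+y. ennreal (indicator K y * exp (- \<rho> y)) * indicator ?X y \<partial>lborel)"
    using pushforward[of ?X] pre by simp
  have x: "x \<in> ?C" using r by simp
  have a': "0 \<le> a'" using F[OF x] by (smt (verit) exp_ge_zero)
  have e': "0 \<le> e'" using E[OF x] by (smt (verit) exp_ge_zero)
  have "ennreal a * ennreal c = (\<integral>\<^sup>+x. ennreal a * indicator ?C x \<partial>lborel)"
    by (simp add: nn_integral_cmult_indicator ec)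
  also have "\<dots> \<le> (\<integral>\<^sup>+x. ennreal (exp (- \<psi> x)) * indicator ?C x \<partial>lborel)"
    using F by (intro nn_integral_mono) (auto simp: indicator_def intro: ennreal_leI)
  also have "\<dots> \<le> (\<integral>\<^sup>+y. ennreal e' * indicator ?X y \<partial>lborel)"
    unfolding eq using E C by (intro nn_integral_mono) (auto simp: indicator_def intro: ennreal_leI)
  also have "\<dots> = ennreal e' * ennreal m" by (simp add: nn_integral_cmult_indicator em)
  finally have "a * c \<le> e' * m"
    using nonneg c m0 e' by (simp add: ennreal_mult[symmetric] ennreal_le_iff)
  also have "\<dots> \<le> e' * (d' * c)" using bnd(1) e' by (intro mult_left_mono) auto
  finally show "a \<le> e' * d'" using c by simp
  have "ennreal e * ennreal m = (\<integral>\<^sup>+x. ennreal e * indicator ?X x \<partial>lborel)"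
    by (simp add: nn_integral_cmult_indicator em)
  also have "\<dots> \<le> (\<integral>\<^sup>+y. ennreal (indicator K y * exp (- \<rho> y)) * indicator ?X y \<partial>lborel)"
    using E C by (intro nn_integral_mono) (auto simp: indicator_def intro: ennreal_leI)
  also have "\<dots> \<le> (\<integral>\<^sup>+x. ennreal a' * indicator ?C x \<partial>lborel)"
    unfolding eq[symmetric] using F by (intro nn_integral_mono) (auto simp: indicator_def intro: ennreal_leI)
  also have "\<dots> = ennreal a' * ennreal c" by (simp add: nn_integral_cmult_indicator ec)
  finally have "e * m \<le> a' * c"
    using nonneg c m0 a' by (simp add: ennreal_mult[symmetric] ennreal_le_iff)
  moreover have "e * (d * c) \<le> e * m" using bnd(2) nonneg by (intro mult_left_mono) auto
  ultimately have "(e * d) * c \<le> a' * c" by (simp add: mult.assoc)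
  then show "e * d \<le> a'" using c by simp
qed

text \<open>On a small ball the three functions \<open>F\<close>, \<open>E\<close>, \<open>D\<close> vary by factors between \<open>s\<close> and \<open>1/s\<close>, where \<open>s\<^sup>3 = q\<close>. The comparison of
masses then gives the equation up to the factor \<open>q\<close>, and \<open>q\<close> may be arbitrarily close to 1.\<close>
lemma equation_at:
  assumes x: "grad \<psi> x \<in> K" "det (hess \<psi> x) \<noteq> 0"
  shows "exp (- \<rho> (grad \<psi> x)) * det (hess \<psi> x) = exp (- \<psi> x)"
proof -
  define F where "F = (\<lambda>z. exp (- \<psi> z))"
  define E where "E = (\<lambda>z. exp (- \<rho> (grad \<psi> z)))"
  define D where "D = (\<lambda>z. det (hess \<psi> z))"
  have contF: "isCont F x" unfolding F_def
    using smooth_continuous[OF smooth_psi, of UNIV] by (intro continuous_intros) (auto simp: continuous_on_eq_continuous_at)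
  have contD: "isCont D x" unfolding D_def
    using continuous_on_det_hess[OF smooth_psi, of UNIV] by (auto simp: continuous_on_eq_continuous_at)
  have contg: "isCont (grad \<psi>) x"
    using continuous_on_grad[OF smooth_psi, of UNIV] by (auto simp: continuous_on_eq_continuous_at)
  have "isCont \<rho> (grad \<psi> x)" using cont_rho K(1) x(1) by (simp add: continuous_on_eq_continuous_at)
  then have contE: "isCont E x" unfolding E_def
    using contg by (intro continuous_intros isCont_o2[of x "grad \<psi>" \<rho>])
  have pos: "F x > 0" "E x > 0" "D x > 0" using pos_def_if(1)[OF x(2)] by (auto simp: F_def E_def D_def)
  have key: "q * F x \<le> E x * D x \<and> q * (E x * D x) \<le> F x" if q: "0 < q" "q < 1" for q
  proof -
    define s where "s = root 3 q"
    have s: "0 < s" "s < 1" "s ^ 3 = q" using q by (auto simp: s_def real_root_lt_1_iff)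
    have near: "\<forall>\<^sub>F z in at x within UNIV. s * G x < G z \<and> G z < G x / s" if "isCont G x" "G x > 0" for G :: "real^'n \<Rightarrow> real"
    proof -
      have "s * G x < G x" "G x < G x / s" using s that by (auto simp: field_simps)
      then show ?thesis
        using that(1) order_tendstoD[of G "G x" "at x"] by (auto simp: isCont_def intro: eventually_conj)
    qed
    have "\<forall>\<^sub>F z in at x. grad \<psi> z \<in> K"
      using contg K(1) x(1) by (auto simp: isCont_def intro: topological_tendstoD)
    moreover note near[OF contF pos(1)] near[OF contE pos(2)] near[OF contD pos(3)]
    ultimately have "\<forall>\<^sub>F z in at x. grad \<psi> z \<in> K \<and> (s * F x < F z \<and> F z < F x / s) \<and> (s * E x < E z \<and> E z < E x / s)
       \<and> (s * D x < D z \<and> D z < D x / s)"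
      by (simp only: eventually_conj_iff)
    then obtain r where r: "r > 0" and br: "\<And>z. z \<noteq> x \<Longrightarrow> dist z x < r \<Longrightarrow>
        grad \<psi> z \<in> K \<and> (s * F x < F z \<and> F z < F x / s) \<and> (s * E x < E z \<and> E z < E x / s)
       \<and> (s * D x < D z \<and> D z < D x / s)"
      unfolding eventually_at by auto
    have bx: "s * F x < F x" "F x < F x / s" "s * E x < E x" "E x < E x / s" "s * D x < D x" "D x < D x / s"
      using s pos by (auto simp: field_simps)
    have all: "grad \<psi> z \<in> K \<and> (s * F x < F z \<and> F z < F x / s) \<and> (s * E x < E z \<and> E z < E x / s)
       \<and> (s * D x < D z \<and> D z < D x / s)" if "z \<in> cball x (r / 2)" for z
      using br[of z] that r bx x(1) by (cases "z = x") (auto simp: dist_commute)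
    have sD: "0 < s * D x" using s pos by simp
    have r2: "r / 2 > 0" using r by simp
    have p1: "\<And>z. z \<in> cball x (r / 2) \<Longrightarrow> grad \<psi> z \<in> K \<and> det (hess \<psi> z) \<noteq> 0"
      using all sD by (force simp: D_def)
    have p2: "\<And>z. z \<in> cball x (r / 2) \<Longrightarrow> s * F x \<le> exp (- \<psi> z) \<and> exp (- \<psi> z) \<le> F x / s"
      using all by (force simp: F_def)
    have p3: "\<And>z. z \<in> cball x (r / 2) \<Longrightarrow>
        s * E x \<le> exp (- \<rho> (grad \<psi> z)) \<and> exp (- \<rho> (grad \<psi> z)) \<le> E x / s"
      using all by (force simp: E_def)
    have p4: "\<And>z. z \<in> cball x (r / 2) \<Longrightarrow> s * D x \<le> det (hess \<psi> z) \<and> det (hess \<psi> z) \<le> D x / s"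
      using all by (force simp: D_def)
    have p5: "0 \<le> s * F x" "0 \<le> s * E x" using s pos by auto
    have cmp: "s * F x \<le> (E x / s) * (D x / s)" "(s * E x) * (s * D x) \<le> F x / s"
      by (rule ball_comparison[OF r2 p1 p2 p3 p4 p5]; assumption)+
    have s3: "s * (s * s) = q" using s(3) by (simp add: power3_eq_cube mult.assoc)
    have "(s * (s * s)) * F x \<le> E x * D x" using cmp(1) s(1) by (simp add: field_simps)
    moreover have "(s * (s * s)) * (E x * D x) \<le> F x" using cmp(2) s(1) by (simp add: field_simps)
    ultimately show ?thesis unfolding s3 by blast
  qed
  have "F x \<le> E x * D x" by (rule field_le_mult_one_interval) (use key in blast)
  moreover have "E x * D x \<le> F x" by (rule field_le_mult_one_interval) (use key in blast)
  ultimately show ?thesis by (simp add: F_def E_def D_def)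
qed

lemma closed_dense_UNIV:
  assumes "closed S" "\<And>x. grad \<psi> x \<in> K \<Longrightarrow> det (hess \<psi> x) \<noteq> 0 \<Longrightarrow> x \<in> S"
  shows "x \<in> S"
proof (rule ccontr)
  assume "x \<notin> S"
  then have "open (- S)" "- S \<noteq> {}" using assms(1) by auto
  from nondegenerate_dense[OF this] assms(2) show False by auto
qed

text \<open>On a dense set the equation gives \<open>det A = exp (\<rho>(y)) exp (-\<psi>) \<ge> exp (-M) exp (-\<psi>)\<close>, a closed condition.\<close>
lemma det_nonzero: "det (hess \<psi> x) \<noteq> 0"
proof -
  obtain M where M: "\<And>y. y \<in> K \<Longrightarrow> \<bar>\<rho> y\<bar> \<le> M"
    using bd_rho by (auto simp: bounded_iff)
  let ?S = "{x. exp (- M) * exp (- \<psi> x) \<le> det (hess \<psi> x)}"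
  have "closed ?S"
    by (intro closed_Collect_le continuous_intros smooth_continuous smooth_psi continuous_on_det_hess)
  then have "x \<in> ?S"
  proof (rule closed_dense_UNIV, goal_cases)
    case (1 x)
    then have "exp (- \<psi> x) = exp (- \<rho> (grad \<psi> x)) * det (hess \<psi> x)" using equation_at by simp
    then have "exp (- M) * exp (- \<psi> x) = exp (- M - \<rho> (grad \<psi> x)) * det (hess \<psi> x)"
      by (simp add: exp_diff exp_minus divide_inverse mult.assoc)
    also have "\<dots> \<le> 1 * det (hess \<psi> x)"
      using M[of "grad \<psi> x"] 1 pos_def_if(1)[of x] by (intro mult_right_mono) auto
    finally show ?case by simp
  qed
  moreover have "0 < exp (- M) * exp (- \<psi> x)" by simp
  ultimately show ?thesis by (metis less_le_not_le mem_Collect_eq)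
qed

text \<open>By continuity the gradient has values in the closure of \<open>K\<close>. It is injective, so its range is open by invariance of
domain and lies in the interior of that closure, which is the open convex set \<open>K\<close> itself.\<close>
lemma grad_in_K: "grad \<psi> x \<in> K"
proof -
  have "grad \<psi> z \<in> closure K" for z
  proof -
    have "closed (grad \<psi> -` closure K)"
      using continuous_on_grad[OF smooth_psi, of UNIV] by (simp add: continuous_on_closed_vimage)
    then have "z \<in> grad \<psi> -` closure K"
      by (rule closed_dense_UNIV) (use closure_subset in auto)
    then show ?thesis by simp
  qed
  moreover have "open (range (grad \<psi>))"
    by (intro invariance_of_domain continuous_on_grad smooth_psi) (auto intro!: injI grad_inj[OF det_nonzero])
  ultimately have "range (grad \<psi>) \<subseteq> interior (closure K)" by (intro interior_maximal) auto
  also have "\<dots> = K" using K by (simp add: convex_interior_closure interior_open)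
  finally show ?thesis by auto
qed

lemma ln_det_hess: "ln (det (hess \<psi> x)) = \<rho> (grad \<psi> x) - \<psi> x"
proof -
  have "exp (\<rho> (grad \<psi> x) - \<psi> x) = exp (\<rho> (grad \<psi> x)) * (exp (- \<rho> (grad \<psi> x)) * det (hess \<psi> x))"
    using equation_at[OF grad_in_K det_nonzero] by (simp add: exp_diff exp_minus field_simps)
  also have "\<dots> = det (hess \<psi> x)" by (simp add: exp_minus)
  finally show ?thesis using ln_exp by metis
qed

text \<open>Since \<open>\<psi>\<close> is Lipschitz with constant \<open>R\<close>, the unit ball around each point with \<open>\<psi> \<le> T\<close> has mass at least \<open>c\<close> for \<open>e\<^sup>-\<^sup>\<psi>\<close>.
The mass outside a large ball is smaller than \<open>c\<close>, so all these points lie within a bounded region.\<close>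
lemma bounded_sublevel: "bounded {x. \<psi> x \<le> T}"
proof -
  obtain R where R: "\<And>y. y \<in> K \<Longrightarrow> norm y \<le> R" using bdK by (auto simp: bounded_iff)
  have lip: "\<psi> z \<le> \<psi> x + R" if "dist x z \<le> 1" for x z
  proof -
    have "\<psi> z + grad \<psi> z \<bullet> (x - z) \<le> \<psi> x"
      using convex_on_above_tangent[OF convex_psi, of z x] smooth_differentiable[OF smooth_psi]
      by (simp add: grad_inner)
    moreover have "- (grad \<psi> z \<bullet> (x - z)) \<le> norm (grad \<psi> z) * norm (x - z)"
      by (metis Cauchy_Schwarz_ineq2 abs_le_D2)
    moreover have "norm (grad \<psi> z) * norm (x - z) \<le> R * 1"
      using that R[OF grad_in_K[of z]] by (intro mult_mono) (auto simp: dist_norm intro: order_trans[OF norm_ge_zero])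
    ultimately show ?thesis by linarith
  qed
  have int: "integrable lborel (\<lambda>x. exp (- \<psi> x))" using int_psi by (auto simp: has_bochner_integral_iff)
  let ?f = "\<lambda>k x. indicator (- ball 0 (real k)) x *\<^sub>R exp (- \<psi> x)"
  have lim: "(\<lambda>k. integral\<^sup>L lborel (?f k)) \<longlonglongrightarrow> integral\<^sup>L lborel (\<lambda>x::real^'n. 0::real)"
  proof (rule integral_dominated_convergence[where w = "\<lambda>x. exp (- \<psi> x)"])
    show "AE x in lborel. (\<lambda>k. ?f k x) \<longlonglongrightarrow> 0"
    proof (rule AE_I2)
      fix x :: "real^'n"
      obtain k0 where k0: "norm x < real k0" using reals_Archimedean2 by blast
      have "\<forall>\<^sub>F k in sequentially. ?f k x = 0"
        using eventually_ge_at_top[of k0] by eventually_elim (use k0 in \<open>auto simp: indicator_def\<close>)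
      then show "(\<lambda>k. ?f k x) \<longlonglongrightarrow> 0" by (rule tendsto_eventually)
    qed
  qed (use int in \<open>auto simp: indicator_def\<close>)
  define c where "c = exp (- T - R) * measure lborel (cball (0::real^'n) 1)"
  have "c > 0" by (simp add: c_def content_cball_pos)
  then have "\<forall>\<^sub>F k in sequentially. integral\<^sup>L lborel (?f k) < c"
    using order_tendstoD(2)[OF lim, of c] by simp
  then obtain k where k: "integral\<^sup>L lborel (?f k) < c" by (auto simp: eventually_sequentially)
  have "norm x \<le> real k + 1" if "\<psi> x \<le> T" for x
  proof (rule ccontr)
    assume nx: "\<not> norm x \<le> real k + 1"
    have sub: "z \<in> - ball 0 (real k)" if "z \<in> cball x 1" for z
    proof -
      have "norm x \<le> norm z + dist x z" by (metis add.commute diff_add_cancel dist_norm norm_triangle_ineq)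
      then show ?thesis using that nx by simp
    qed
    have "c = integral\<^sup>L lborel (\<lambda>z. indicator (cball x 1) z *\<^sub>R exp (- T - R))"
      by (simp add: c_def content_cball)
    also have "\<dots> \<le> integral\<^sup>L lborel (?f k)"
    proof (rule integral_mono)
      show "integrable lborel (\<lambda>z. indicator (cball x 1) z *\<^sub>R exp (- T - R))"
        by (intro borel_integrable_compact) auto
      show "integrable lborel (?f k)"
        by (rule Bochner_Integration.integrable_bound[OF int]) (auto simp: indicator_def)
      fix z
      show "indicator (cball x 1) z *\<^sub>R exp (- T - R) \<le> ?f k z"
      proof (cases "z \<in> cball x 1")
        case True
        then have "\<psi> z \<le> T + R" using lip[of x z] that by auto
        then show ?thesis using True sub[OF True] by (simp add: indicator_def)
      qed (simp add: indicator_def)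
    qed
    finally show False using k by simp
  qed
  then show ?thesis by (auto simp: bounded_iff)
qed

lemma rho_above_tangent:
  "y \<in> K \<Longrightarrow> y' \<in> K \<Longrightarrow> \<rho> y + dir_deriv (y' - y) \<rho> y \<le> \<rho> y'"
  by (intro convex_on_above_tangent[OF K(3)] diff_rho)

end

section \<open>The linearized equation and its maximum principle\<close>

lemma continuous_attains_global_max:
  fixes F :: "'a::euclidean_space \<Rightarrow> real"
  assumes cont: "continuous_on UNIV F" and bd: "bounded {x. F a \<le> F x}"
  obtains x where "\<And>z. F z \<le> F x" 
proof -
  let ?S = "{x. F a \<le> F x}"
  have "closed ?S" by (intro closed_Collect_le cont continuous_intros)
  then have "compact ?S" using bd by (simp add: compact_eq_bounded_closed)
  moreover have "a \<in> ?S" by simp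
  ultimately obtain x where x: "x \<in> ?S" "\<And>z. z \<in> ?S \<Longrightarrow> F z \<le> F x"
    using continuous_attains_sup[of ?S F] continuous_on_subset[OF cont] by blast
  have "F z \<le> F x" for z using x(2)[of z] x(1) by (cases "z \<in> ?S") auto
  with that show thesis by blast
qed

lemma inner_has_real_derivative:
  assumes "(F has_vector_derivative F') (at t)" "(G has_vector_derivative G') (at t)"
  shows "((\<lambda>t. F t \<bullet> G t) has_real_derivative F' \<bullet> G t + F t \<bullet> G') (at t)"
proof -
  have "(\<lambda>h. F t \<bullet> (h *\<^sub>R G') + (h *\<^sub>R F') \<bullet> G t) = (*) (F' \<bullet> G t + F t \<bullet> G')"
    by (auto simp: fun_eq_iff algebra_simps)
  then show ?thesis
    using has_derivative_inner[OF assms[unfolded has_vector_derivative_def]]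
    by (simp add: has_field_derivative_def)
qed

lemma smooth_laplacian: "smooth f \<Longrightarrow> smooth (laplacian f)"
  unfolding laplacian_def[abs_def] by (intro smooth_sum smooth_partial_deriv)

locale moment_map_bounded_gradient = moment_map \<mu> K \<rho> \<psi>
  for \<mu> :: "(real^'n) measure" and K :: "(real^'n) set" and \<rho> \<psi> :: "real^'n \<Rightarrow> real" +
  fixes R M :: real
  assumes K_R: "\<And>y. y \<in> K \<Longrightarrow> norm y \<le> R"
    and grad_rho: "\<And>y. y \<in> K \<Longrightarrow> norm (grad \<rho> y) \<le> M"
begin

lemma pos_def: "v \<noteq> 0 \<Longrightarrow> 0 < v \<bullet> (hess \<psi> x *v v)" and det_pos: "0 < det (hess \<psi> x)"
  using pos_def_if det_nonzero by blast+

lemma psi_deriv: "dir_deriv v \<psi> x = grad \<psi> x \<bullet> v"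
  by (simp add: grad_inner smooth_differentiable[OF smooth_psi])

lemma rho_tangent: "\<rho> (grad \<psi> x) + grad \<rho> (grad \<psi> x) \<bullet> (grad \<psi> z - grad \<psi> x) \<le> \<rho> (grad \<psi> z)"
  using rho_above_tangent[OF grad_in_K grad_in_K, of x z] by (simp add: grad_inner diff_rho grad_in_K)

lemma psi_bounded_below: obtains L where "\<And>x. L \<le> \<psi> x"
proof -
  have "bounded {x. - \<psi> 0 \<le> - \<psi> x}" using bounded_sublevel[of "\<psi> 0"] by simp
  from continuous_attains_global_max[OF _ this] obtain x where "\<And>z. - \<psi> z \<le> - \<psi> x"
    using continuous_on_minus[OF smooth_continuous[OF smooth_psi]] by metis
  then show thesis using that[of "\<psi> x"] by simp
qed

text \<open>The function \<open>m\<close> is \<open>L \<psi> + \<psi>\<close> with \<open>L\<close> frozen at \<open>x\<close>. By concavity of \<open>log det\<close> its trace part increases from \<open>x\<close> to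
\<open>z\<close> by at least the increment of \<open>log det A = \<rho>(y) - \<psi>\<close>; the added term \<open>\<psi>\<close> cancels the last one, and the drift
subtracts the increment of the tangent plane of \<open>\<rho>\<close> at \<open>y(x)\<close>, which lies below \<open>\<rho>\<close>.\<close>
lemma frozen_operator_minimum:
  fixes f :: "'n \<Rightarrow> real^'n"
  assumes f: "\<And>i j. f i \<bullet> (hess \<psi> x *v f j) = (if i = j then 1 else 0)"
  defines "xi \<equiv> - grad \<rho> (grad \<psi> x)"
  defines "m \<equiv> \<lambda>z. (\<Sum>i\<in>UNIV. dir_deriv (f i) (dir_deriv (f i) \<psi>) z) + dir_deriv xi \<psi> z + \<psi> z"
  shows "smooth m" "m x \<le> m z"
proof -
  show "smooth m" unfolding m_def
    by (intro smooth_add smooth_sum smooth_dir_deriv smooth_psi)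
  have "real CARD('n) + ln (det (hess \<psi> z)) - ln (det (hess \<psi> x)) \<le> (\<Sum>i\<in>UNIV. f i \<bullet> (hess \<psi> z *v f i))"
    by (rule frame_trace_ge_ln_det[OF f det_pos transpose_hess[OF smooth_psi] pos_def])
  then have "real CARD('n) + (\<rho> (grad \<psi> z) - \<psi> z) - (\<rho> (grad \<psi> x) - \<psi> x) \<le> (\<Sum>i\<in>UNIV. dir_deriv (f i) (dir_deriv (f i) \<psi>) z)"
    by (simp add: ln_det_hess inner_hess[OF smooth_psi])
  moreover have "(\<Sum>i\<in>UNIV. dir_deriv (f i) (dir_deriv (f i) \<psi>) x) = real CARD('n)"
    using f by (simp add: inner_hess[OF smooth_psi, symmetric])
  ultimately show "m x \<le> m z"
    using rho_tangent[of x z] by (simp add: m_def psi_deriv xi_def inner_diff_right inner_commute)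
qed

text \<open>The first derivative of the frozen operator vanishes at its minimum: \<open>L(\<partial>\<^sub>e\<psi>) = -\<partial>\<^sub>e\<psi>\<close> for all directions \<open>e\<close>.\<close>
lemma linearized_equation_grad:
  fixes f :: "'n \<Rightarrow> real^'n"
  assumes f: "\<And>i j. f i \<bullet> (hess \<psi> x *v f j) = (if i = j then 1 else 0)"
  shows "(\<Sum>i\<in>UNIV. third_deriv \<psi> (f i) x) = hess \<psi> x *v grad \<rho> (grad \<psi> x) - grad \<psi> x"
proof -
  define xi where "xi = - grad \<rho> (grad \<psi> x)"
  have sm: "smooth (dir_deriv v \<psi>)" "smooth (dir_deriv w (dir_deriv v \<psi>))" for v w
    by (intro smooth_dir_deriv smooth_psi)+
  have "((\<Sum>i\<in>UNIV. third_deriv \<psi> (f i) x) + hess \<psi> x *v xi + grad \<psi> x) \<bullet> e = 0" for e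
  proof -
    have "0 = dir_deriv e (\<lambda>z. (\<Sum>i\<in>UNIV. dir_deriv (f i) (dir_deriv (f i) \<psi>) z) + dir_deriv xi \<psi> z + \<psi> z) x"
      using smooth_min_derivatives(1)[OF frozen_operator_minimum[OF f], of e] by (simp add: xi_def)
    also have "\<dots> = (\<Sum>i\<in>UNIV. dir_deriv e (dir_deriv (f i) (dir_deriv (f i) \<psi>)) x) + dir_deriv e (dir_deriv xi \<psi>) x + dir_deriv e \<psi> x"
      by (simp add: dir_deriv_add dir_deriv_sum smooth_add smooth_sum sm smooth_psi)
    finally show ?thesis
      by (simp add: inner_add_left inner_sum_left third_deriv_inner[OF smooth_psi] hess_inner[OF smooth_psi] psi_deriv)
  qed
  then have "(\<Sum>i\<in>UNIV. third_deriv \<psi> (f i) x) + hess \<psi> x *v xi + grad \<psi> x = 0"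
    by (metis inner_eq_zero_iff)
  moreover have "hess \<psi> x *v xi = - (hess \<psi> x *v grad \<rho> (grad \<psi> x))"
    by (simp add: xi_def linear_neg[OF matrix_vector_mul_linear])
  moreover have "S = h - y" if "S + h' + y = 0" "h' = - h" for S h h' y :: "real^'n"
    using that by (simp add: algebra_simps)
  ultimately show ?thesis by blast
qed

text \<open>The second derivatives of the frozen operator at its minimum are nonnegative; summing them over the coordinate directions gives
\<open>L(\<Delta>\<psi>) \<ge> -\<Delta>\<psi>\<close>.\<close>
lemma linearized_inequality_laplacian:
  fixes f :: "'n \<Rightarrow> real^'n"
  assumes f: "\<And>i j. f i \<bullet> (hess \<psi> x *v f j) = (if i = j then 1 else 0)"
  defines "xi \<equiv> - grad \<rho> (grad \<psi> x)"
  shows "0 \<le> (\<Sum>i\<in>UNIV. dir_deriv (f i) (dir_deriv (f i) (laplacian \<psi>)) x)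
    + dir_deriv xi (laplacian \<psi>) x + laplacian \<psi> x"
proof -
  let ?a = "\<lambda>j. axis j (1::real) :: real^'n"
  let ?D = "\<lambda>j. dir_deriv (?a j) (dir_deriv (?a j) \<psi>)"
  have sm: "smooth g \<Longrightarrow> smooth (dir_deriv v g)" for v and g :: "real^'n \<Rightarrow> real"
    by (rule smooth_dir_deriv)
  have comm: "dir_deriv e (dir_deriv e (dir_deriv v g)) = dir_deriv v (dir_deriv e (dir_deriv e g))"
    if "smooth g" for e v and g :: "real^'n \<Rightarrow> real"
    using dir_deriv_commute[OF that, of e v] dir_deriv_commute[OF sm[OF that], of e v e] by simp
  have lap: "laplacian \<psi> = (\<lambda>z. \<Sum>j\<in>UNIV. ?D j z)"
    by (rule ext) (rule laplacian_eq_trace)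
  have 1: "0 \<le> (\<Sum>i\<in>UNIV. dir_deriv (f i) (dir_deriv (f i) (?D j)) x) + dir_deriv xi (?D j) x + ?D j x" for j
  proof -
    have "0 \<le> dir_deriv (?a j) (dir_deriv (?a j)
        (\<lambda>z. (\<Sum>i\<in>UNIV. dir_deriv (f i) (dir_deriv (f i) \<psi>) z) + dir_deriv xi \<psi> z + \<psi> z)) x"
      using smooth_min_derivatives(2)[OF frozen_operator_minimum[OF f], of "?a j"]
      unfolding xi_def .
    also have "\<dots> = (\<Sum>i\<in>UNIV. dir_deriv (?a j) (dir_deriv (?a j) (dir_deriv (f i) (dir_deriv (f i) \<psi>))) x)
       + dir_deriv (?a j) (dir_deriv (?a j) (dir_deriv xi \<psi>)) x + ?D j x"
      by (simp only: dir_deriv_add dir_deriv_sum smooth_add smooth_sum sm smooth_psi finite_class.finite_UNIV)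
    finally have "0 \<le> (\<Sum>i\<in>UNIV. dir_deriv (?a j) (dir_deriv (?a j) (dir_deriv (f i) (dir_deriv (f i) \<psi>))) x)
       + dir_deriv (?a j) (dir_deriv (?a j) (dir_deriv xi \<psi>)) x + ?D j x" .
    moreover have "dir_deriv (?a j) (dir_deriv (?a j) (dir_deriv (f i) (dir_deriv (f i) \<psi>)))
        = dir_deriv (f i) (dir_deriv (f i) (?D j))" for i
      using comm[OF sm[OF smooth_psi], of "?a j" "f i" "f i"] comm[OF smooth_psi, of "?a j" "f i"] by simp
    moreover have "dir_deriv (?a j) (dir_deriv (?a j) (dir_deriv xi \<psi>)) = dir_deriv xi (?D j)"
      by (rule comm[OF smooth_psi])
    ultimately show ?thesis by (simp only:)
  qed
  have "0 \<le> (\<Sum>j\<in>UNIV. (\<Sum>i\<in>UNIV. dir_deriv (f i) (dir_deriv (f i) (?D j)) x) + dir_deriv xi (?D j) x + ?D j x)"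
    by (rule sum_nonneg) (rule 1)
  also have "\<dots> = (\<Sum>i\<in>UNIV. \<Sum>j\<in>UNIV. dir_deriv (f i) (dir_deriv (f i) (?D j)) x)
      + (\<Sum>j\<in>UNIV. dir_deriv xi (?D j) x) + (\<Sum>j\<in>UNIV. ?D j x)"
    unfolding sum.distrib by (subst sum.swap) simp
  also have "(\<Sum>j\<in>UNIV. dir_deriv xi (?D j) x) = dir_deriv xi (laplacian \<psi>) x"
    unfolding lap by (simp only: dir_deriv_sum sm smooth_psi finite_class.finite_UNIV)
  also have "(\<Sum>i\<in>UNIV. \<Sum>j\<in>UNIV. dir_deriv (f i) (dir_deriv (f i) (?D j)) x)
    = (\<Sum>i\<in>UNIV. dir_deriv (f i) (dir_deriv (f i) (laplacian \<psi>)) x)"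
    unfolding lap by (simp only: dir_deriv_sum smooth_sum sm smooth_psi finite_class.finite_UNIV)
  also have "(\<Sum>j\<in>UNIV. ?D j x) = laplacian \<psi> x" by (simp add: lap)
  finally show ?thesis .
qed

lemma frame_exists:
  obtains f :: "'n \<Rightarrow> real^'n" where "\<And>i j. f i \<bullet> (hess \<psi> x *v f j) = (if i = j then 1 else 0)"
  by (rule simultaneous_diagonalization[OF transpose_hess[OF smooth_psi, of x] pos_def[of _ x]
    transpose_hess[OF smooth_psi, of x]]) (assumption, rule that)

lemma laplacian_frame:
  fixes f :: "'n \<Rightarrow> real^'n"
  assumes f: "\<And>i j. f i \<bullet> (hess \<psi> x *v f j) = (if i = j then 1 else 0)"
  shows "laplacian \<psi> x = (\<Sum>i\<in>UNIV. (hess \<psi> x *v f i) \<bullet> (hess \<psi> x *v f i))"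
proof -
  let ?h = "\<lambda>i. hess \<psi> x *v f i"
  have "laplacian \<psi> x = (\<Sum>j\<in>UNIV. axis j 1 \<bullet> (hess \<psi> x *v axis j 1))"
    unfolding laplacian_eq_trace inner_hess[OF smooth_psi] ..
  also have "\<dots> = (\<Sum>j\<in>UNIV. axis j 1 \<bullet> (\<Sum>i\<in>UNIV. (?h i \<bullet> axis j 1) *\<^sub>R ?h i))"
    by (subst frame_expansion[OF f transpose_hess[OF smooth_psi]]) (rule refl)
  also have "\<dots> = (\<Sum>i\<in>UNIV. \<Sum>j\<in>UNIV. ?h i $ j * ?h i $ j)"
    by (subst sum.swap) (simp add: inner_sum_right inner_axis inner_axis')
  also have "\<dots> = (\<Sum>i\<in>UNIV. ?h i \<bullet> ?h i)" by (simp add: inner_vec_def)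
  finally show ?thesis .
qed

text \<open>This bounds \<open>L \<psi>\<close> from above by \<open>n + R M\<close>, which is what makes \<open>\<epsilon> \<psi>\<close> an admissible penalty.\<close>
lemma drift_bound: "- (grad \<psi> x \<bullet> grad \<rho> (grad \<psi> x)) \<le> R * M"
proof -
  have "- (grad \<psi> x \<bullet> grad \<rho> (grad \<psi> x)) \<le> norm (grad \<psi> x) * norm (grad \<rho> (grad \<psi> x))"
    by (metis Cauchy_Schwarz_ineq2 abs_le_D2)
  also have "\<dots> \<le> R * M"
    using K_R[OF grad_in_K] grad_rho[OF grad_in_K] by (intro mult_mono) (auto intro: order_trans[OF norm_ge_zero])
  finally show ?thesis .
qed

text \<open>At a maximum of \<open>U = \<Delta>\<psi> + c |y|\<^sup>2 - \<epsilon> \<psi>\<close> the second derivatives along the frame are nonpositive and the derivative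
along the drift vanishes, so \<open>L U \<le> 0\<close>. Here \<open>L(\<Delta>\<psi>) \<ge> -\<Delta>\<psi>\<close>, \<open>L(|y|\<^sup>2) = 2 \<Delta>\<psi> - 2 |y|\<^sup>2\<close> and
\<open>L \<psi> \<le> n + R M\<close>.\<close>
lemma laplacian_at_max:
  assumes mx: "\<And>z. laplacian \<psi> z + c * (grad \<psi> z \<bullet> grad \<psi> z) - \<epsilon> * \<psi> z
      \<le> laplacian \<psi> x + c * (grad \<psi> x \<bullet> grad \<psi> x) - \<epsilon> * \<psi> x" and eps: "\<epsilon> \<ge> 0"
  shows "(2 * c - 1) * laplacian \<psi> x \<le> 2 * c * (grad \<psi> x \<bullet> grad \<psi> x) + \<epsilon> * (real CARD('n) + R * M)"
proof -
  obtain f :: "'n \<Rightarrow> real^'n" where f: "\<And>i j. f i \<bullet> (hess \<psi> x *v f j) = (if i = j then 1 else 0)"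
    by (rule frame_exists[of x]) (rule that)
  define xi where "xi = - grad \<rho> (grad \<psi> x)"
  define y where "y = grad \<psi> x"
  define p where "p v t = laplacian \<psi> (x + t *\<^sub>R v) + c * (grad \<psi> (x + t *\<^sub>R v) \<bullet> grad \<psi> (x + t *\<^sub>R v)) - \<epsilon> * \<psi> (x + t *\<^sub>R v)" for v t
  define p' where "p' v t = dir_deriv v (laplacian \<psi>) (x + t *\<^sub>R v)
      + 2 * c * (grad \<psi> (x + t *\<^sub>R v) \<bullet> (hess \<psi> (x + t *\<^sub>R v) *v v)) - \<epsilon> * dir_deriv v \<psi> (x + t *\<^sub>R v)" for v t
  note g = grad_line_deriv[OF smooth_psi]
  have d: "(p v has_real_derivative p' v t) (at t)" for v t
    unfolding p_def p'_def
    by (rule DERIV_cong[OF DERIV_diff[OF DERIV_add[OF smooth_line_deriv[OF smooth_laplacian[OF smooth_psi]]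
        DERIV_cmult[OF inner_has_real_derivative[OF g g]]] DERIV_cmult[OF smooth_line_deriv[OF smooth_psi]]]])
      (simp add: inner_commute)
  have d2: "(p' v has_real_derivative dir_deriv v (dir_deriv v (laplacian \<psi>)) (x + t *\<^sub>R v)
      + 2 * c * ((hess \<psi> (x + t *\<^sub>R v) *v v) \<bullet> (hess \<psi> (x + t *\<^sub>R v) *v v) + grad \<psi> (x + t *\<^sub>R v) \<bullet> third_deriv \<psi> v (x + t *\<^sub>R v))
      - \<epsilon> * dir_deriv v (dir_deriv v \<psi>) (x + t *\<^sub>R v)) (at t)" for v t
    unfolding p'_def
    by (rule DERIV_diff[OF DERIV_add[OF smooth_line_deriv[OF smooth_dir_deriv[OF smooth_laplacian[OF smooth_psi]]]
        DERIV_cmult[OF inner_has_real_derivative[OF g hess_line_deriv[OF smooth_psi]]]]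
        DERIV_cmult[OF smooth_line_deriv[OF smooth_dir_deriv[OF smooth_psi]]]])
  have pm: "p v t \<le> p v 0" for v t using mx[of "x + t *\<^sub>R v"] by (simp add: p_def)
  have first: "dir_deriv xi (laplacian \<psi>) x + 2 * c * (y \<bullet> (hess \<psi> x *v xi)) - \<epsilon> * (y \<bullet> xi) = 0"
    using second_derivative_test_max(1)[OF d d2 pm, of xi] by (simp add: p'_def y_def psi_deriv)
  have "dir_deriv (f i) (dir_deriv (f i) (laplacian \<psi>)) x
      + 2 * c * ((hess \<psi> x *v f i) \<bullet> (hess \<psi> x *v f i) + y \<bullet> third_deriv \<psi> (f i) x) - \<epsilon> \<le> 0" for i
    using second_derivative_test_max(2)[OF d d2 pm, of "f i"] f[of i i]
    by (simp add: y_def inner_hess[OF smooth_psi])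
  then have "(\<Sum>i\<in>UNIV. dir_deriv (f i) (dir_deriv (f i) (laplacian \<psi>)) x
      + 2 * c * ((hess \<psi> x *v f i) \<bullet> (hess \<psi> x *v f i) + y \<bullet> third_deriv \<psi> (f i) x) - \<epsilon>) \<le> 0"
    by (intro sum_nonpos)
  then have "(\<Sum>i\<in>UNIV. dir_deriv (f i) (dir_deriv (f i) (laplacian \<psi>)) x)
      + 2 * c * (laplacian \<psi> x + y \<bullet> (\<Sum>i\<in>UNIV. third_deriv \<psi> (f i) x)) - real CARD('n) * \<epsilon> \<le> 0"
    by (simp add: sum.distrib sum_subtractf sum_distrib_left[symmetric] laplacian_frame[OF f] inner_sum_right)
  moreover have "y \<bullet> (\<Sum>i\<in>UNIV. third_deriv \<psi> (f i) x) = - (y \<bullet> (hess \<psi> x *v xi)) - y \<bullet> y"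
    unfolding linearized_equation_grad[OF f] xi_def
    by (simp add: y_def inner_diff_right linear_neg[OF matrix_vector_mul_linear])
  moreover note linearized_inequality_laplacian[OF f, folded xi_def] first
  moreover have "\<epsilon> * (y \<bullet> xi) \<le> \<epsilon> * (R * M)"
    using drift_bound[of x] eps by (intro mult_left_mono) (auto simp: xi_def y_def)
  ultimately show ?thesis unfolding y_def[symmetric] by (simp add: algebra_simps)
qed

end

section \<open>Two-point function: conditions at a maximum\<close>

text \<open>The function \<open>two_point\<close> introduced below, restricted to the line through \<open>(x\<^sub>1, x\<^sub>2)\<close> in the direction \<open>(u, w)\<close>, with
\<open>Y1\<close>, \<open>Y2\<close> the gradients at the two moving points, \<open>s1\<close>, \<open>s2\<close> the values of \<open>\<psi>\<close> there, and \<open>Z\<close> the difference of the points.\<close>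
lemma two_point_derivatives:
  fixes Y1 Y2 A B Z :: "real \<Rightarrow> 'v::real_inner" and s1 s2 :: "real \<Rightarrow> real" and a k \<epsilon> :: real
  assumes Y1: "\<And>t. (Y1 has_vector_derivative A t) (at t)" and Y2: "\<And>t. (Y2 has_vector_derivative B t) (at t)"
    and Z: "\<And>t. (Z has_vector_derivative u - w) (at t)"
    and s1: "\<And>t. (s1 has_real_derivative Y1 t \<bullet> u) (at t)" and s2: "\<And>t. (s2 has_real_derivative Y2 t \<bullet> w) (at t)"
    and A: "(A has_vector_derivative S1) (at 0)" and B: "(B has_vector_derivative S2) (at 0)"
  defines "d \<equiv> \<lambda>t. Y1 t - Y2 t"
  defines "p \<equiv> \<lambda>t. (a + k / 2 * (Y1 t \<bullet> Y1 t)) / 2 * (d t \<bullet> d t) - s1 t + s2 t + Y2 t \<bullet> Z t - \<epsilon> * (s1 t + s2 t)"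
  defines "p' \<equiv> \<lambda>t. k / 2 * (Y1 t \<bullet> A t) * (d t \<bullet> d t) + (a + k / 2 * (Y1 t \<bullet> Y1 t)) * (d t \<bullet> (A t - B t))
      - d t \<bullet> u + B t \<bullet> Z t - \<epsilon> * (Y1 t \<bullet> u + Y2 t \<bullet> w)"
  shows "(p has_real_derivative p' t) (at t)"
    and "(p' has_real_derivative k / 2 * (A 0 \<bullet> A 0 + Y1 0 \<bullet> S1) * (d 0 \<bullet> d 0) + 2 * k * (Y1 0 \<bullet> A 0) * (d 0 \<bullet> (A 0 - B 0))
      + (a + k / 2 * (Y1 0 \<bullet> Y1 0)) * ((A 0 - B 0) \<bullet> (A 0 - B 0) + d 0 \<bullet> (S1 - S2))
      - (A 0 - B 0) \<bullet> u + S2 \<bullet> Z 0 + B 0 \<bullet> (u - w) - \<epsilon> * (A 0 \<bullet> u + B 0 \<bullet> w)) (at 0)"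
proof -
  have c: "((\<lambda>t. v) has_vector_derivative 0) (at t)" for v :: 'v and t by (rule has_vector_derivative_const)
  have d: "(d has_vector_derivative A t - B t) (at t)" for t
    unfolding d_def by (rule has_vector_derivative_diff[OF Y1 Y2])
  have dH: "((\<lambda>t. a + k / 2 * (Y1 t \<bullet> Y1 t)) has_real_derivative k * (Y1 t \<bullet> A t)) (at t)" for t
    by (rule DERIV_cong[OF DERIV_add[OF DERIV_const DERIV_cmult[OF inner_has_real_derivative[OF Y1 Y1]]]])
      (simp add: inner_commute)
  have dN: "((\<lambda>t. d t \<bullet> d t) has_real_derivative 2 * (d t \<bullet> (A t - B t))) (at t)" for t
    by (rule DERIV_cong[OF inner_has_real_derivative[OF d d]]) (simp add: inner_commute)
  note iY = inner_has_real_derivative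
  show "(p has_real_derivative p' t) (at t)"
    unfolding p_def
  proof (rule DERIV_cong[OF DERIV_diff[OF DERIV_add[OF DERIV_add[OF DERIV_diff[OF
      DERIV_mult[OF DERIV_cdivide[OF dH] dN] s1] s2] iY[OF Y2 Z]] DERIV_cmult[OF DERIV_add[OF s1 s2]]]])
    show "k * (Y1 t \<bullet> A t) / 2 * (d t \<bullet> d t) + 2 * (d t \<bullet> (A t - B t)) * ((a + k / 2 * (Y1 t \<bullet> Y1 t)) / 2) - Y1 t \<bullet> u + Y2 t \<bullet> w
      + (B t \<bullet> Z t + Y2 t \<bullet> (u - w)) - \<epsilon> * (Y1 t \<bullet> u + Y2 t \<bullet> w) = p' t"
    proof -
      have e: "Y2 t \<bullet> u = Y1 t \<bullet> u - d t \<bullet> u" by (simp add: d_def inner_diff_left)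
      show ?thesis unfolding p'_def inner_diff_right[of "Y2 t" u w] e by (simp add: field_simps)
    qed
  qed
  have dAB: "((\<lambda>t. A t - B t) has_vector_derivative S1 - S2) (at 0)"
    by (rule has_vector_derivative_diff[OF A B])
  show "(p' has_real_derivative k / 2 * (A 0 \<bullet> A 0 + Y1 0 \<bullet> S1) * (d 0 \<bullet> d 0) + 2 * k * (Y1 0 \<bullet> A 0) * (d 0 \<bullet> (A 0 - B 0))
      + (a + k / 2 * (Y1 0 \<bullet> Y1 0)) * ((A 0 - B 0) \<bullet> (A 0 - B 0) + d 0 \<bullet> (S1 - S2))
      - (A 0 - B 0) \<bullet> u + S2 \<bullet> Z 0 + B 0 \<bullet> (u - w) - \<epsilon> * (A 0 \<bullet> u + B 0 \<bullet> w)) (at 0)"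
    unfolding p'_def
    by (rule DERIV_cong[OF DERIV_diff[OF DERIV_add[OF DERIV_diff[OF DERIV_add[OF
      DERIV_mult[OF DERIV_cmult[OF iY[OF Y1 A]] dN] DERIV_mult[OF dH iY[OF d dAB]]] iY[OF d c]] iY[OF B Z]]
      DERIV_cmult[OF DERIV_add[OF iY[OF Y1 c] iY[OF Y2 c]]]]])
      (simp add: algebra_simps)
qed

context moment_map_bounded_gradient
begin

text \<open>The claim \<open>two_point a k 0 \<le> 0\<close> is a strong form of convexity, \<open>\<psi>(x\<^sub>1) - \<psi>(x\<^sub>2) - y\<^sub>2 \<cdot> (x\<^sub>1 - x\<^sub>2) \<ge> H(y\<^sub>1) |y\<^sub>1 - y\<^sub>2|\<^sup>2 / 2\<close>, that bounds the
second derivatives of \<open>\<psi>\<close> from above. The weight \<open>H = a + k |y\<^sub>1|\<^sup>2 / 2\<close> must not be constant: its second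
derivatives along the frame supply the positive term \<open>k |y\<^sub>1 - y\<^sub>2|\<^sup>2 tr A(x\<^sub>1) / 2\<close> that drives the argument.\<close>
definition two_point :: "real \<Rightarrow> real \<Rightarrow> real \<Rightarrow> real^'n \<Rightarrow> real^'n \<Rightarrow> real" where
  "two_point a k \<epsilon> x1 x2 =
    (a + k / 2 * (grad \<psi> x1 \<bullet> grad \<psi> x1)) / 2 * ((grad \<psi> x1 - grad \<psi> x2) \<bullet> (grad \<psi> x1 - grad \<psi> x2))
    - \<psi> x1 + \<psi> x2 + grad \<psi> x2 \<bullet> (x1 - x2) - \<epsilon> * (\<psi> x1 + \<psi> x2)"

text \<open>The maximum principle in the product space. The direction \<open>f\<^sub>i\<close> at \<open>x\<^sub>1\<close> is coupled with \<open>g\<^sub>i\<close> at \<open>x\<^sub>2\<close>, where \<open>f\<close> is orthonormal for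
\<open>A(x\<^sub>1)\<close>, diagonalizes \<open>A(x\<^sub>2)\<close> with entries \<open>m\<^sub>i\<close>, and \<open>g\<^sub>i = f\<^sub>i / sqrt m\<^sub>i\<close> is orthonormal for \<open>A(x\<^sub>2)\<close>. The mixed
second derivatives then contribute \<open>2 \<Sum> (sqrt m\<^sub>i - 1) \<ge> \<Sum> ln m\<^sub>i = ln det A(x\<^sub>2) - ln det A(x\<^sub>1)\<close>, and the equation
together with convexity of \<open>\<rho>\<close> turns this into \<open>\<psi>(x\<^sub>1) - \<psi>(x\<^sub>2)\<close> up to drift terms. The second conclusion
is the first-order condition in \<open>x\<^sub>1\<close>, the third the sum of the second-order conditions.\<close>
lemma two_point_at_max:
  fixes a k \<epsilon> :: real
  assumes mx: "\<And>z1 z2. two_point a k \<epsilon> z1 z2 \<le> two_point a k \<epsilon> x1 x2" and eps: "\<epsilon> \<ge> 0"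
  defines "d \<equiv> grad \<psi> x1 - grad \<psi> x2" and "H \<equiv> a + k / 2 * (grad \<psi> x1 \<bullet> grad \<psi> x1)"
  obtains al de :: "'n \<Rightarrow> real^'n" where
    "\<And>v. hess \<psi> x1 *v v = (\<Sum>i\<in>UNIV. (al i \<bullet> v) *\<^sub>R al i)"
    "hess \<psi> x1 *v (H *\<^sub>R d + (k / 2 * (d \<bullet> d)) *\<^sub>R grad \<psi> x1) = d + \<epsilon> *\<^sub>R grad \<psi> x1"
    "k / 2 * (d \<bullet> d) * ((\<Sum>i\<in>UNIV. al i \<bullet> al i) - grad \<psi> x1 \<bullet> grad \<psi> x1)
      + (\<Sum>i\<in>UNIV. 2 * k * ((grad \<psi> x1 \<bullet> al i) * (d \<bullet> de i)) + H * (de i \<bullet> de i))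
      - H * (d \<bullet> d) + (\<psi> x1 - \<psi> x2 - grad \<psi> x2 \<bullet> (x1 - x2)) \<le> \<epsilon> * (2 * (real CARD('n) + R * M))"
proof -
  note sy = transpose_hess[OF smooth_psi]
  define y1 y2 z where "y1 = grad \<psi> x1" and "y2 = grad \<psi> x2" and "z = x1 - x2"
  define A1 A2 where "A1 = hess \<psi> x1" and "A2 = hess \<psi> x2"
  define N where "N = d \<bullet> d"
  have dH: "d = y1 - y2" "H = a + k / 2 * (y1 \<bullet> y1)" by (simp_all add: d_def H_def y1_def y2_def)
  \<comment> \<open>First- and second-order conditions along an arbitrary direction \<open>(u, w)\<close>.\<close>
  have first: "k / 2 * (y1 \<bullet> (A1 *v u)) * N + H * (d \<bullet> (A1 *v u - A2 *v w)) - d \<bullet> u + (A2 *v w) \<bullet> z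
        - \<epsilon> * (y1 \<bullet> u + y2 \<bullet> w) = 0" (is ?first)
    and second: "k / 2 * ((A1 *v u) \<bullet> (A1 *v u) + y1 \<bullet> third_deriv \<psi> u x1) * N
      + 2 * k * (y1 \<bullet> (A1 *v u)) * (d \<bullet> (A1 *v u - A2 *v w))
      + H * ((A1 *v u - A2 *v w) \<bullet> (A1 *v u - A2 *v w) + d \<bullet> (third_deriv \<psi> u x1 - third_deriv \<psi> w x2))
      - (A1 *v u - A2 *v w) \<bullet> u + third_deriv \<psi> w x2 \<bullet> z + (A2 *v w) \<bullet> (u - w)
      - \<epsilon> * ((A1 *v u) \<bullet> u + (A2 *v w) \<bullet> w) \<le> 0" (is ?second) for u w
  proof -
    let ?Z = "\<lambda>t. x1 + t *\<^sub>R u - (x2 + t *\<^sub>R w)"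
    have Z: "(?Z has_vector_derivative u - w) (at t)" for t
      by (auto intro!: derivative_eq_intros)
    have s: "((\<lambda>t. \<psi> (x + t *\<^sub>R v)) has_real_derivative grad \<psi> (x + t *\<^sub>R v) \<bullet> v) (at t)" for x v t
      using smooth_line_deriv[OF smooth_psi, of x v t] by (simp add: psi_deriv)
    have h: "((\<lambda>t. hess \<psi> (x + t *\<^sub>R v) *v v) has_vector_derivative third_deriv \<psi> v x) (at 0)" for x v
      using hess_line_deriv[OF smooth_psi, of x v 0] by simp
    note der = two_point_derivatives[OF grad_line_deriv[OF smooth_psi, of x1 u] grad_line_deriv[OF smooth_psi, of x2 w]
      Z s[of x1 u] s[of x2 w] h[of x1 u] h[of x2 w],
      where a = a and k = k and \<epsilon> = \<epsilon>]
    note test = second_derivative_test_max[OF der]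
    have m: "(a + k / 2 * (grad \<psi> (x1 + t *\<^sub>R u) \<bullet> grad \<psi> (x1 + t *\<^sub>R u))) / 2 *
         ((grad \<psi> (x1 + t *\<^sub>R u) - grad \<psi> (x2 + t *\<^sub>R w)) \<bullet> (grad \<psi> (x1 + t *\<^sub>R u) - grad \<psi> (x2 + t *\<^sub>R w)))
         - \<psi> (x1 + t *\<^sub>R u) + \<psi> (x2 + t *\<^sub>R w) + grad \<psi> (x2 + t *\<^sub>R w) \<bullet> ?Z t
         - \<epsilon> * (\<psi> (x1 + t *\<^sub>R u) + \<psi> (x2 + t *\<^sub>R w)) = two_point a k \<epsilon> (x1 + t *\<^sub>R u) (x2 + t *\<^sub>R w)" for t
      by (simp add: two_point_def)
    note test' = test[unfolded m, simplified, OF mx]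
    show ?first ?second
      using test' by (simp_all add: y1_def y2_def A1_def A2_def N_def z_def dH)
  qed
  obtain f :: "'n \<Rightarrow> real^'n" and m where f: "\<And>i j. f i \<bullet> (A1 *v f j) = (if i = j then 1 else 0)"
    and fm: "\<And>i j. f i \<bullet> (A2 *v f j) = (if i = j then m j else 0)"
    and f0: "\<And>i. f i \<noteq> 0" and dm: "det A2 = det A1 * (\<Prod>i\<in>UNIV. m i)"
    by (rule simultaneous_diagonalization[OF sy[of x1, folded A1_def] pos_def[of _ x1, folded A1_def]
      sy[of x2, folded A2_def]]) (assumption, rule that)
  have mpos: "m i > 0" for i using pos_def[OF f0[of i], of x2] fm[of i i] by (simp add: A2_def)
  define g where "g i = (1 / sqrt (m i)) *\<^sub>R f i" for i
  have A2g: "A2 *v g i = (1 / sqrt (m i)) *\<^sub>R (A2 *v f i)" for i by (simp add: g_def matrix_vector_mult_scaleR)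
  have g: "g i \<bullet> (A2 *v g j) = (if i = j then 1 else 0)" for i j
    using mpos[of j] by (simp add: A2g) (simp add: g_def fm real_div_sqrt)
  define al be de where "al i = A1 *v f i" and "be i = A2 *v g i" and "de i = al i - be i" for i
  have bf: "be i \<bullet> f i = sqrt (m i)" for i
    using mpos[of i] fm[of i i] by (simp add: be_def A2g inner_commute real_div_sqrt)
  have "ln (det A2) - ln (det A1) = (\<Sum>i\<in>UNIV. ln (m i))"
    unfolding dm using det_pos[of x1] mpos by (simp add: A1_def ln_mult prod_pos ln_prod less_imp_neq[symmetric])
  also have "\<dots> \<le> (\<Sum>i\<in>UNIV. 2 * (be i \<bullet> f i) - 2)"
  proof (rule sum_mono)
    fix i
    have "ln (m i) = 2 * ln (sqrt (m i))" using mpos[of i] by (simp add: ln_sqrt)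
    also have "\<dots> \<le> 2 * (sqrt (m i) - 1)" using mpos[of i] by (intro mult_left_mono ln_le_minus_one) auto
    finally show "ln (m i) \<le> 2 * (be i \<bullet> f i) - 2" by (simp add: bf)
  qed
  also have "\<dots> = 2 * (\<Sum>i\<in>UNIV. be i \<bullet> f i) - 2 * real CARD('n)" by (simp add: sum_subtractf sum_distrib_left)
  finally have ln: "ln (det A2) - ln (det A1) \<le> 2 * (\<Sum>i\<in>UNIV. be i \<bullet> f i) - 2 * real CARD('n)" .
  define r1 r2 where "r1 = grad \<rho> y1" and "r2 = grad \<rho> y2"
  define T1 T2 where "T1 = (\<Sum>i\<in>UNIV. third_deriv \<psi> (f i) x1)" and "T2 = (\<Sum>i\<in>UNIV. third_deriv \<psi> (g i) x2)"
  have T: "T1 = A1 *v r1 - y1" "T2 = A2 *v r2 - y2"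
    unfolding T1_def T2_def r1_def r2_def y1_def y2_def A1_def A2_def
    using f g by (auto intro!: linearized_equation_grad simp: A1_def A2_def)
  define tau where "tau = (\<Sum>i\<in>UNIV. al i \<bullet> al i)"
  define Q where "Q = (\<Sum>i\<in>UNIV. 2 * k * ((y1 \<bullet> al i) * (d \<bullet> de i)) + H * (de i \<bullet> de i))"
  have "k / 2 * N * (al i \<bullet> al i) + k / 2 * N * (y1 \<bullet> third_deriv \<psi> (f i) x1)
      + (2 * k * ((y1 \<bullet> al i) * (d \<bullet> de i)) + H * (de i \<bullet> de i)) + H * (d \<bullet> third_deriv \<psi> (f i) x1) - H * (d \<bullet> third_deriv \<psi> (g i) x2)
      + z \<bullet> third_deriv \<psi> (g i) x2 + 2 * (be i \<bullet> f i) - (2 + 2 * \<epsilon>) \<le> 0" for i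
  proof -
    have 1: "al i \<bullet> f i = 1" "be i \<bullet> g i = 1"
      using f[of i i] g[of i i] by (simp_all add: al_def be_def inner_commute)
    then have "de i \<bullet> f i = 1 - be i \<bullet> f i" "be i \<bullet> (f i - g i) = be i \<bullet> f i - 1"
      by (simp_all add: de_def inner_diff_left inner_diff_right)
    then show ?thesis
      using second[of "f i" "g i", folded al_def be_def, folded de_def] 1
      by (simp add: inner_diff_right[of d] inner_commute[of z] algebra_simps)
  qed
  then have "(\<Sum>i\<in>UNIV. k / 2 * N * (al i \<bullet> al i) + k / 2 * N * (y1 \<bullet> third_deriv \<psi> (f i) x1)
      + (2 * k * ((y1 \<bullet> al i) * (d \<bullet> de i)) + H * (de i \<bullet> de i)) + H * (d \<bullet> third_deriv \<psi> (f i) x1) - H * (d \<bullet> third_deriv \<psi> (g i) x2)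
      + z \<bullet> third_deriv \<psi> (g i) x2 + 2 * (be i \<bullet> f i) - (2 + 2 * \<epsilon>)) \<le> 0"
    by (intro sum_nonpos)
  also have "(\<Sum>i\<in>UNIV. k / 2 * N * (al i \<bullet> al i) + k / 2 * N * (y1 \<bullet> third_deriv \<psi> (f i) x1)
      + (2 * k * ((y1 \<bullet> al i) * (d \<bullet> de i)) + H * (de i \<bullet> de i)) + H * (d \<bullet> third_deriv \<psi> (f i) x1) - H * (d \<bullet> third_deriv \<psi> (g i) x2)
      + z \<bullet> third_deriv \<psi> (g i) x2 + 2 * (be i \<bullet> f i) - (2 + 2 * \<epsilon>))
    = k / 2 * N * tau + k / 2 * N * (y1 \<bullet> T1) + Q + H * (d \<bullet> T1) - H * (d \<bullet> T2) + z \<bullet> T2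
      + 2 * (\<Sum>i\<in>UNIV. be i \<bullet> f i) - real CARD('n) * (2 + 2 * \<epsilon>)"
    unfolding sum.distrib[of "\<lambda>i. _ i + _ i"] sum_subtractf tau_def Q_def T1_def T2_def inner_sum_right sum_distrib_left
    by (simp add: sum.distrib sum_subtractf)
  finally have sum: "k / 2 * N * tau + k / 2 * N * (y1 \<bullet> T1) + Q + H * (d \<bullet> T1) - H * (d \<bullet> T2) + z \<bullet> T2
      + 2 * (\<Sum>i\<in>UNIV. be i \<bullet> f i) - real CARD('n) * (2 + 2 * \<epsilon>) \<le> 0" .
  \<comment> \<open>The sum still contains \<open>A1 r1\<close> and \<open>A2 r2\<close>; the first-order condition along \<open>(r1, r2)\<close> cancels both.\<close>
  have rho: "\<rho> y1 - \<rho> y2 \<le> d \<bullet> r1"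
    using rho_tangent[of x1 x2] by (simp add: y1_def y2_def r1_def d_def inner_diff_left inner_diff_right inner_commute)
  have "\<epsilon> * - (y1 \<bullet> r1) \<le> \<epsilon> * (R * M)" "\<epsilon> * - (y2 \<bullet> r2) \<le> \<epsilon> * (R * M)"
    using mult_left_mono[OF drift_bound[of x1] eps] mult_left_mono[OF drift_bound[of x2] eps]
    by (simp_all add: y1_def y2_def r1_def r2_def)
  moreover have "d \<bullet> T1 - d \<bullet> T2 = d \<bullet> (A1 *v r1 - A2 *v r2) - N"
    by (simp add: T N_def dH inner_diff_right inner_diff_left)
  then have "H * (d \<bullet> T1) - H * (d \<bullet> T2) = H * (d \<bullet> (A1 *v r1 - A2 *v r2)) - H * N"
    by (metis right_diff_distrib)
  moreover have "k / 2 * N * (y1 \<bullet> T1) = k / 2 * (y1 \<bullet> (A1 *v r1)) * N - k / 2 * N * (y1 \<bullet> y1)"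
    by (simp add: T inner_diff_right algebra_simps)
  moreover have "z \<bullet> T2 = (A2 *v r2) \<bullet> z - y2 \<bullet> z" by (simp add: T inner_diff_right inner_commute)
  moreover have "ln (det A1) = \<rho> y1 - \<psi> x1" "ln (det A2) = \<rho> y2 - \<psi> x2"
    by (simp_all add: A1_def A2_def y1_def y2_def ln_det_hess)
  moreover have "k / 2 * (y1 \<bullet> (A1 *v r1)) * N + (H * (d \<bullet> (A1 *v r1 - A2 *v r2))) - d \<bullet> r1 + (A2 *v r2) \<bullet> z
        + (\<epsilon> * - (y1 \<bullet> r1) + \<epsilon> * - (y2 \<bullet> r2)) = 0"
    using first[of r1 r2] by (simp add: algebra_simps)
  moreover have "real CARD('n) * (2 + 2 * \<epsilon>) = 2 * real CARD('n) + 2 * (\<epsilon> * real CARD('n))"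
    by (simp add: algebra_simps)
  moreover note sum rho ln
  ultimately have "k / 2 * N * tau - k / 2 * N * (y1 \<bullet> y1) + Q - H * N + (\<psi> x1 - \<psi> x2 - y2 \<bullet> z)
      \<le> 2 * (\<epsilon> * real CARD('n)) + 2 * (\<epsilon> * (R * M))"
    by linarith
  moreover have "k / 2 * N * (tau - y1 \<bullet> y1) = k / 2 * N * tau - k / 2 * N * (y1 \<bullet> y1)"
    by (rule right_diff_distrib)
  moreover have "\<epsilon> * (2 * (real CARD('n) + R * M)) = 2 * (\<epsilon> * real CARD('n)) + 2 * (\<epsilon> * (R * M))"
    by (simp add: algebra_simps)
  ultimately have "k / 2 * N * (tau - y1 \<bullet> y1) + Q - H * N + (\<psi> x1 - \<psi> x2 - y2 \<bullet> z) \<le> \<epsilon> * (2 * (real CARD('n) + R * M))"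
    by linarith
  moreover have "hess \<psi> x1 *v v = (\<Sum>i\<in>UNIV. (al i \<bullet> v) *\<^sub>R al i)" for v
    unfolding al_def A1_def by (rule frame_expansion[OF f[unfolded A1_def] sy])
  moreover have "A1 *v (H *\<^sub>R d + (k / 2 * N) *\<^sub>R y1) = d + \<epsilon> *\<^sub>R y1"
  proof -
    have "(A1 *v (H *\<^sub>R d + (k / 2 * N) *\<^sub>R y1) - (d + \<epsilon> *\<^sub>R y1)) \<bullet> u = 0" for u
    proof -
      have "(A1 *v v) \<bullet> u = v \<bullet> (A1 *v u)" for v
        using sy by (metis A1_def dot_lmul_matrix inner_commute vector_transpose_matrix)
      then show ?thesis using first[of u 0]
        by (simp add: inner_diff_left inner_add_left algebra_simps)
    qed
    then show ?thesis by (metis inner_eq_zero_iff right_minus_eq)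
  qed
  ultimately show thesis
    using that[of al de] by (simp add: tau_def Q_def N_def y1_def y2_def z_def A1_def)
qed

end

section \<open>Bounded second derivatives and the sharp bound\<close>

context moment_map_bounded_gradient
begin

definition bregman :: "real^'n \<Rightarrow> real^'n \<Rightarrow> real" where
  "bregman x1 x2 = \<psi> x1 - \<psi> x2 - grad \<psi> x2 \<bullet> (x1 - x2)"

lemma bregman_nonneg: "0 \<le> bregman x1 x2"
  using convex_on_above_tangent[OF convex_psi, of x2 x1] smooth_differentiable[OF smooth_psi]
  by (simp add: bregman_def psi_deriv)

lemma two_point_eq:
  "two_point a k \<epsilon> x1 x2 = (a + k / 2 * (grad \<psi> x1 \<bullet> grad \<psi> x1)) / 2 *
     ((grad \<psi> x1 - grad \<psi> x2) \<bullet> (grad \<psi> x1 - grad \<psi> x2)) - bregman x1 x2 - \<epsilon> * (\<psi> x1 + \<psi> x2)"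
  by (simp add: two_point_def bregman_def)

lemma norm_grad: "norm (grad \<psi> x) \<le> R"
  by (rule K_R[OF grad_in_K])

lemma inner_grad: "grad \<psi> x \<bullet> grad \<psi> x \<le> R\<^sup>2"
  using power_mono[OF norm_grad, of x 2] by (simp add: power2_norm_eq_inner)

lemma norm_grad_diff: "norm (grad \<psi> x1 - grad \<psi> x2) \<le> 2 * R"
  using norm_triangle_ineq4[of "grad \<psi> x1" "grad \<psi> x2"] norm_grad[of x1] norm_grad[of x2] by linarith

lemma M_nonneg: "0 \<le> M"
  using grad_rho[OF grad_in_K, of 0] norm_ge_zero[of "grad \<rho> (grad \<psi> 0)"] by linarith

text \<open>At a maximum of the penalized two-point function, the first-order condition \<open>A q = d + \<epsilon> y\<close> with \<open>|q|\<close> of order \<open>k R\<^sup>2 |d|\<close> forces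
\<open>tr A\<close> to be at least \<open>1 / (11 k R\<^sup>2)\<close>. The term \<open>k |d|\<^sup>2 tr A / 2\<close> loses half to the mixed terms, for which \<open>a = 4 k R\<^sup>2\<close> is
chosen to complete a square, and the other half is at least \<open>|d|\<^sup>2 / (44 R\<^sup>2)\<close>. The value of \<open>k\<close> makes the
remaining negative terms, at most \<open>5 k R\<^sup>2 |d|\<^sup>2\<close>, consume half of that.\<close>
lemma two_point_gap:
  fixes \<epsilon> :: real
  assumes R: "R > 0"
  defines "k \<equiv> 1 / (440 * R^4)"
  defines "a \<equiv> 4 * k * R\<^sup>2"
  assumes mx: "\<And>z1 z2. two_point a k \<epsilon> z1 z2 \<le> two_point a k \<epsilon> x1 x2" and eps: "\<epsilon> \<ge> 0"
  defines "d \<equiv> grad \<psi> x1 - grad \<psi> x2"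
  assumes d0: "d \<noteq> 0" and big: "2 * \<epsilon> * R \<le> norm d"
  shows "(d \<bullet> d) / (88 * R\<^sup>2) \<le> \<epsilon> * (2 * (real CARD('n) + R * M))"
proof -
  define y where "y = grad \<psi> x1"
  define H where "H = a + k / 2 * (y \<bullet> y)"
  have k: "k > 0" using R by (simp add: k_def)
  have y: "norm y \<le> R" "y \<bullet> y \<le> R\<^sup>2" "y \<bullet> y \<ge> 0" using norm_grad inner_grad by (simp_all add: y_def)
  have H: "4 * k * R\<^sup>2 \<le> H" "H \<le> 9 / 2 * k * R\<^sup>2"
    using y k mult_left_mono[OF y(2), of "k / 2"] by (auto simp: H_def a_def)
  have Hpos: "H > 0" using H(1) k R by (smt (verit) mult_pos_pos zero_less_power)
  obtain al de :: "'n \<Rightarrow> real^'n" where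
    exp: "\<And>v. hess \<psi> x1 *v v = (\<Sum>i\<in>UNIV. (al i \<bullet> v) *\<^sub>R al i)" and
    first: "hess \<psi> x1 *v (H *\<^sub>R d + (k / 2 * (d \<bullet> d)) *\<^sub>R y) = d + \<epsilon> *\<^sub>R y" and
    ineq: "k / 2 * (d \<bullet> d) * ((\<Sum>i\<in>UNIV. al i \<bullet> al i) - y \<bullet> y)
      + (\<Sum>i\<in>UNIV. 2 * k * ((y \<bullet> al i) * (d \<bullet> de i)) + H * (de i \<bullet> de i))
      - H * (d \<bullet> d) + bregman x1 x2 \<le> \<epsilon> * (2 * (real CARD('n) + R * M))"
    using two_point_at_max[OF mx eps] unfolding d_def H_def y_def bregman_def by blast
  define tau where "tau = (\<Sum>i\<in>UNIV. al i \<bullet> al i)"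
  define q where "q = H *\<^sub>R d + (k / 2 * (d \<bullet> d)) *\<^sub>R y"
  define N where "N = d \<bullet> d"
  have N: "N = (norm d)\<^sup>2" "N > 0" using d0 by (simp_all add: N_def power2_norm_eq_inner)
  have nd: "norm d > 0" "norm d \<le> 2 * R" using d0 norm_grad_diff by (simp_all add: d_def)
  have tau0: "tau \<ge> 0" by (simp add: tau_def sum_nonneg)
  have nq: "norm q \<le> norm d * (11 / 2 * k * R\<^sup>2)"
  proof -
    have "norm q \<le> H * norm d + k / 2 * N * norm y"
      unfolding q_def using Hpos k N norm_triangle_ineq[of "H *\<^sub>R d" "(k / 2 * (d \<bullet> d)) *\<^sub>R y"]
      by (simp add: N_def)
    also have "k / 2 * N * norm y \<le> k / 2 * (norm d * (2 * R)) * R"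
      using nd y k R by (intro mult_mono) (auto simp: N power2_eq_square)
    also have "H * norm d \<le> 9 / 2 * k * R\<^sup>2 * norm d" using H nd by (intro mult_right_mono) auto
    finally show ?thesis by (simp add: algebra_simps power2_eq_square)
  qed
  have "norm (d + \<epsilon> *\<^sub>R y) \<ge> norm d / 2"
  proof -
    have "norm (\<epsilon> *\<^sub>R y) \<le> \<epsilon> * R" using y eps by (simp add: mult_left_mono)
    moreover have "norm d - norm (\<epsilon> *\<^sub>R y) \<le> norm (d + \<epsilon> *\<^sub>R y)" by (rule norm_diff_ineq)
    ultimately show ?thesis using big by linarith
  qed
  also have "d + \<epsilon> *\<^sub>R y = (\<Sum>i\<in>UNIV. (al i \<bullet> q) *\<^sub>R al i)" using first exp by (simp add: q_def)
  also have "norm \<dots> \<le> (\<Sum>i\<in>UNIV. (al i \<bullet> al i) * norm q)"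
  proof (rule sum_norm_le)
    fix i
    have "norm ((al i \<bullet> q) *\<^sub>R al i) \<le> norm (al i) * norm q * norm (al i)"
      using Cauchy_Schwarz_ineq2[of "al i" q] by (simp add: mult_right_mono)
    then show "norm ((al i \<bullet> q) *\<^sub>R al i) \<le> (al i \<bullet> al i) * norm q"
      by (simp add: power2_norm_eq_inner[symmetric] power2_eq_square mult_ac)
  qed
  also have "\<dots> = tau * norm q" by (simp add: tau_def sum_distrib_right)
  also have "\<dots> \<le> tau * (norm d * (11 / 2 * k * R\<^sup>2))" using nq tau0 by (rule mult_left_mono)
  finally have "norm d * 1 \<le> norm d * (tau * (11 * k * R\<^sup>2))" by (simp add: algebra_simps)
  then have "1 \<le> tau * (11 * k * R\<^sup>2)" using nd by (simp only: mult_le_cancel_left_pos)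
  then have tau: "1 / (44 * R\<^sup>2) \<le> k / 4 * tau" using R by (simp add: field_simps)
  \<comment> \<open>Completing the square in \<open>norm (de i)\<close>, with \<open>4 k R\<^sup>2 \<le> H\<close>.\<close>
  have "- (k / 4) * N * (al i \<bullet> al i) \<le> 2 * k * ((y \<bullet> al i) * (d \<bullet> de i)) + H * (de i \<bullet> de i)" for i
  proof -
    have "\<bar>(y \<bullet> al i) * (d \<bullet> de i)\<bar> \<le> (R * norm (al i)) * (norm d * norm (de i))"
      unfolding abs_mult using Cauchy_Schwarz_ineq2[of y "al i"] Cauchy_Schwarz_ineq2[of d "de i"]
        mult_right_mono[OF y(1), of "norm (al i)"] R
      by (intro mult_mono) auto
    then have "- ((R * norm (al i)) * (norm d * norm (de i))) \<le> (y \<bullet> al i) * (d \<bullet> de i)" by linarith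
    then have 1: "2 * k * - ((R * norm (al i)) * (norm d * norm (de i))) \<le> 2 * k * ((y \<bullet> al i) * (d \<bullet> de i))"
      using k by (intro mult_left_mono) auto
    have 2: "4 * k * R\<^sup>2 * (norm (de i))\<^sup>2 \<le> H * (de i \<bullet> de i)"
      using H by (simp add: power2_norm_eq_inner mult_right_mono)
    have "0 \<le> k * (2 * R * norm (de i) - norm (al i) * norm d / 2)\<^sup>2" using k by simp
    also have "\<dots> = 4 * k * R\<^sup>2 * (norm (de i))\<^sup>2 + 2 * k * - ((R * norm (al i)) * (norm d * norm (de i)))
        + k / 4 * (norm d)\<^sup>2 * (norm (al i))\<^sup>2"
      by (simp add: power2_eq_square algebra_simps)
    finally have "0 \<le> H * (de i \<bullet> de i) + 2 * k * ((y \<bullet> al i) * (d \<bullet> de i)) + k / 4 * (norm d)\<^sup>2 * (norm (al i))\<^sup>2"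
      using 1 2 by linarith
    then show ?thesis by (simp add: N power2_norm_eq_inner)
  qed
  then have "(\<Sum>i\<in>UNIV. - (k / 4) * N * (al i \<bullet> al i)) \<le>
      (\<Sum>i\<in>UNIV. 2 * k * ((y \<bullet> al i) * (d \<bullet> de i)) + H * (de i \<bullet> de i))"
    by (intro sum_mono)
  then have cross: "- (k / 4) * N * tau \<le> (\<Sum>i\<in>UNIV. 2 * k * ((y \<bullet> al i) * (d \<bullet> de i)) + H * (de i \<bullet> de i))"
    by (simp add: tau_def sum_distrib_left)
  have "k / 2 * N * (tau - y \<bullet> y) = 2 * (N * (k / 4 * tau)) - N * (k / 2 * (y \<bullet> y))"
    "- (k / 4) * N * tau = - (N * (k / 4 * tau))"
    by (simp_all add: field_simps)
  moreover have "p - q - h \<le> e"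
    if "a = 2 * p - q" "b = - p" "a + s - h + B \<le> e" "b \<le> s" "0 \<le> B" for a b p q s h B e :: real
    using that by linarith
  ultimately have "N * (k / 4 * tau) - N * (k / 2 * (y \<bullet> y)) - H * N \<le> \<epsilon> * (2 * (real CARD('n) + R * M))"
    using ineq[folded tau_def N_def] cross bregman_nonneg[of x1 x2] by blast
  then have "N * (k / 4 * tau) - N * (k / 2 * (y \<bullet> y)) - N * H \<le> \<epsilon> * (2 * (real CARD('n) + R * M))"
    by (simp only: mult.commute[of N H])
  moreover have "N * (1 / (44 * R\<^sup>2)) \<le> N * (k / 4 * tau)" using tau N by (intro mult_left_mono) auto
  moreover have "N * (k / 2 * (y \<bullet> y)) \<le> N * (k / 2 * R\<^sup>2)" using y k N by (intro mult_left_mono) auto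
  moreover have "N * H \<le> N * (9 / 2 * k * R\<^sup>2)" using H N by (intro mult_left_mono) auto
  moreover have "N * (1 / (44 * R\<^sup>2)) - N * (k / 2 * R\<^sup>2) - N * (9 / 2 * k * R\<^sup>2) = N / (88 * R\<^sup>2)"
    using R by (simp add: k_def field_simps power4_eq_xxxx power2_eq_square)
  ultimately show ?thesis unfolding N_def by linarith
qed

lemma two_point_attains_max:
  assumes a: "a \<ge> 0" and k: "k \<ge> 0" and eps: "\<epsilon> > 0"
  obtains x1 x2 where "\<And>z1 z2. two_point a k \<epsilon> z1 z2 \<le> two_point a k \<epsilon> x1 x2"
proof -
  let ?F = "\<lambda>p. two_point a k \<epsilon> (fst p) (snd p)"
  obtain L where L: "\<And>x. L \<le> \<psi> x" using psi_bounded_below by blast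
  define B where "B = (a + k / 2 * R\<^sup>2) / 2 * (2 * R)\<^sup>2"
  have up: "two_point a k \<epsilon> x1 x2 \<le> B - \<epsilon> * (\<psi> x1 + \<psi> x2)" for x1 x2
  proof -
    have "(grad \<psi> x1 - grad \<psi> x2) \<bullet> (grad \<psi> x1 - grad \<psi> x2) \<le> (2 * R)\<^sup>2"
      using power_mono[OF norm_grad_diff, of x1 x2 2] by (simp add: power2_norm_eq_inner)
    then have "(a + k / 2 * (grad \<psi> x1 \<bullet> grad \<psi> x1)) / 2 *
        ((grad \<psi> x1 - grad \<psi> x2) \<bullet> (grad \<psi> x1 - grad \<psi> x2)) \<le> B"
      unfolding B_def using inner_grad[of x1] a k
      by (intro mult_mono divide_right_mono add_mono mult_left_mono) auto
    then show ?thesis using bregman_nonneg[of x1 x2] unfolding two_point_eq by linarith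
  qed
  have "continuous_on UNIV ?F"
    unfolding two_point_def
    by (intro continuous_intros continuous_on_compose2[OF continuous_on_grad[OF smooth_psi, of UNIV]]
      continuous_on_compose2[OF smooth_continuous[OF smooth_psi, of UNIV]]) auto
  moreover have "bounded {p. ?F (0, 0) \<le> ?F p}"
  proof -
    define T where "T = (B - ?F (0, 0)) / \<epsilon> - L"
    have "\<psi> x1 \<le> T \<and> \<psi> x2 \<le> T" if "?F (0, 0) \<le> two_point a k \<epsilon> x1 x2" for x1 x2
    proof -
      have "\<epsilon> * (\<psi> x1 + \<psi> x2) \<le> B - ?F (0, 0)" using up[of x1 x2] that by simp
      then have "\<psi> x1 + \<psi> x2 \<le> (B - ?F (0, 0)) / \<epsilon>" using eps by (simp add: field_simps)
      then show ?thesis using L[of x1] L[of x2] by (simp add: T_def)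
    qed
    then have "{p. ?F (0, 0) \<le> ?F p} \<subseteq> {x. \<psi> x \<le> T} \<times> {x. \<psi> x \<le> T}" by auto
    then show ?thesis using bounded_Times[OF bounded_sublevel bounded_sublevel] bounded_subset by blast
  qed
  ultimately obtain p where "\<And>z. ?F z \<le> ?F p" using continuous_attains_global_max by blast
  from this[of "(_, _)"] show thesis using that[of "fst p" "snd p"] by simp
qed

text \<open>A positive value \<open>m\<close> would persist at a maximum of the penalized function for small \<open>\<epsilon>\<close>, keeping \<open>|d|\<^sup>2\<close> above a
constant \<open>N0\<close> independent of \<open>\<epsilon>\<close>, whereas \<open>two_point_gap\<close> makes \<open>|d|\<^sup>2\<close> of order \<open>\<epsilon>\<close>.\<close>
lemma two_point_nonpos:
  assumes R: "R > 0"
  defines "k \<equiv> 1 / (440 * R^4)"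
  defines "a \<equiv> 4 * k * R\<^sup>2"
  shows "two_point a k 0 a1 a2 \<le> 0"
proof (rule ccontr)
  define m where "m = two_point a k 0 a1 a2"
  assume "\<not> ?thesis"
  then have m: "m > 0" by (simp add: m_def)
  have k: "k > 0" using R by (simp add: k_def)
  have a: "a \<ge> 0" using k by (simp add: a_def)
  obtain L where L: "\<And>x. L \<le> \<psi> x" using psi_bounded_below by blast
  define S where "S = \<psi> a1 + \<psi> a2 - 2 * L"
  have S: "S \<ge> 0" using L[of a1] L[of a2] by (simp add: S_def)
  define C where "C = 2 * (real CARD('n) + R * M)"
  have C: "C \<ge> 0" using R M_nonneg by (simp add: C_def)
  define N0 where "N0 = m / (9 / 2 * k * R\<^sup>2)"
  have N0: "N0 > 0" using m k R by (simp add: N0_def)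
  define e where "e = min (min 1 (N0 / (4 * R\<^sup>2))) (min (N0 / (88 * R\<^sup>2) / (2 * (C + 1))) (m / (2 * (S + 1))))"
  have e: "e > 0" using N0 R C S m by (simp add: e_def)
  have e1: "e \<le> 1" "e \<le> N0 / (4 * R\<^sup>2)" "e \<le> N0 / (88 * R\<^sup>2) / (2 * (C + 1))" "e \<le> m / (2 * (S + 1))"
    by (auto simp: e_def)
  obtain x1 x2 where mx: "\<And>z1 z2. two_point a k e z1 z2 \<le> two_point a k e x1 x2"
    using two_point_attains_max[OF a less_imp_le[OF k] e] by blast
  define d where "d = grad \<psi> x1 - grad \<psi> x2"
  define N where "N = d \<bullet> d"
  have split: "two_point a k e z1 z2 = two_point a k 0 z1 z2 - e * (\<psi> z1 + \<psi> z2)" for z1 z2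
    by (simp add: two_point_def)
  have "m - e * (\<psi> a1 + \<psi> a2) \<le> two_point a k 0 x1 x2 - e * (\<psi> x1 + \<psi> x2)"
    using mx[of a1 a2] by (simp add: split m_def)
  moreover have "e * (2 * L) \<le> e * (\<psi> x1 + \<psi> x2)" using e L[of x1] L[of x2] by (intro mult_left_mono) auto
  moreover have "e * (2 * (S + 1)) \<le> m" using e1(4) S by (simp add: field_simps)
  then have "e * S \<le> m / 2" using e by (simp add: algebra_simps)
  moreover have "e * S = e * (\<psi> a1 + \<psi> a2) - e * (2 * L)" by (simp add: S_def algebra_simps)
  ultimately have "m / 2 \<le> two_point a k 0 x1 x2" by linarith
  also have "\<dots> \<le> (a + k / 2 * (grad \<psi> x1 \<bullet> grad \<psi> x1)) / 2 * N"
    using bregman_nonneg[of x1 x2] by (simp add: two_point_eq N_def d_def)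
  also have "\<dots> \<le> (9 / 2 * k * R\<^sup>2) / 2 * N"
    using inner_grad[of x1] k mult_left_mono[OF inner_grad[of x1], of "k / 2"]
    by (intro mult_right_mono divide_right_mono) (auto simp: a_def N_def)
  finally have NN0: "N0 \<le> N" using k R by (simp add: N0_def field_simps)
  then have d0: "d \<noteq> 0" using N0 by (auto simp: N_def)
  have "2 * e * R \<le> norm d"
  proof (rule power2_le_imp_le)
    have "(2 * e * R)\<^sup>2 = e * (e * (4 * R\<^sup>2))" by (simp add: power2_eq_square)
    also have "\<dots> \<le> 1 * (e * (4 * R\<^sup>2))" using e1 e R by (intro mult_right_mono) auto
    also have "\<dots> \<le> N0" using e1(2) R by (simp add: field_simps)
    finally show "(2 * e * R)\<^sup>2 \<le> (norm d)\<^sup>2" using NN0 by (simp add: N_def power2_norm_eq_inner)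
  qed simp
  from two_point_gap[OF R mx[unfolded a_def k_def] less_imp_le[OF e] d0[unfolded d_def] this[unfolded d_def]]
  have "N / (88 * R\<^sup>2) \<le> e * C" by (simp add: N_def d_def C_def)
  moreover have "N0 / (88 * R\<^sup>2) \<le> N / (88 * R\<^sup>2)" using NN0 by (intro divide_right_mono) auto
  moreover have "e * (2 * (C + 1)) \<le> N0 / (88 * R\<^sup>2)" using e1(3) C by (subst (asm) pos_le_divide_eq) auto
  moreover have "e * C < e * (2 * (C + 1))" using e C by (intro mult_strict_left_mono) auto
  ultimately show False by linarith
qed

text \<open>Adding the two-point inequality for \<open>(x\<^sub>1, x\<^sub>2)\<close> and \<open>(x\<^sub>2, x\<^sub>1)\<close> gives \<open>|d|\<^sup>2 \<le> 110 R\<^sup>2 d \<cdot> (x\<^sub>1 - x\<^sub>2)\<close>, a Lipschitz bound for the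
gradient.\<close>
lemma second_derivative_bounded:
  assumes R: "R > 0" and v: "norm v = 1"
  shows "dir_deriv v (dir_deriv v \<psi>) x \<le> 110 * R\<^sup>2"
proof (rule ccontr)
  assume "\<not> ?thesis"
  then have pos: "0 < dir_deriv v (dir_deriv v \<psi>) x - 110 * R\<^sup>2" by simp
  define k where "k = 1 / (440 * R^4)"
  have k: "k > 0" using R by (simp add: k_def)
  have co: "(d \<bullet> d) / (220 * R\<^sup>2) \<le> bregman x1 x2" if "d = grad \<psi> x1 - grad \<psi> x2" for d x1 x2
  proof -
    have "two_point (4 * k * R\<^sup>2) k 0 x1 x2 \<le> 0" using two_point_nonpos[OF R] by (simp add: k_def)
    then have "(4 * k * R\<^sup>2 + k / 2 * (grad \<psi> x1 \<bullet> grad \<psi> x1)) / 2 * (d \<bullet> d) \<le> bregman x1 x2"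
      by (simp add: two_point_eq that)
    moreover have "(4 * k * R\<^sup>2) / 2 * (d \<bullet> d) \<le> (4 * k * R\<^sup>2 + k / 2 * (grad \<psi> x1 \<bullet> grad \<psi> x1)) / 2 * (d \<bullet> d)"
      using k by (intro mult_right_mono divide_right_mono) auto
    moreover have "(4 * k * R\<^sup>2) / 2 * (d \<bullet> d) = (d \<bullet> d) / (220 * R\<^sup>2)"
      using R by (simp add: k_def field_simps power4_eq_xxxx power2_eq_square)
    ultimately show ?thesis by linarith
  qed
  have step: "(grad \<psi> (x + t *\<^sub>R v) - grad \<psi> x) \<bullet> v \<le> 110 * R\<^sup>2 * t" if t: "t > 0" for t
  proof -
    define d where "d = grad \<psi> (x + t *\<^sub>R v) - grad \<psi> x"
    have "d \<bullet> d / (220 * R\<^sup>2) \<le> bregman (x + t *\<^sub>R v) x" by (rule co) (simp add: d_def)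
    moreover have "d \<bullet> d / (220 * R\<^sup>2) \<le> bregman x (x + t *\<^sub>R v)"
      using co[of "- d" x "x + t *\<^sub>R v"] unfolding inner_minus_left inner_minus_right by (simp add: d_def)
    moreover have "bregman (x + t *\<^sub>R v) x + bregman x (x + t *\<^sub>R v) = t * (d \<bullet> v)"
      by (simp add: bregman_def d_def inner_diff_left algebra_simps)
    ultimately have 1: "d \<bullet> d / (110 * R\<^sup>2) \<le> t * (d \<bullet> v)" by simp
    have 2: "d \<bullet> v \<le> norm d" using norm_cauchy_schwarz[of d v] v by simp
    have "norm d * norm d \<le> 110 * R\<^sup>2 * (t * (d \<bullet> v))"
      using 1 R by (simp add: field_simps power2_norm_eq_inner[symmetric] power2_eq_square)
    also have "\<dots> \<le> 110 * R\<^sup>2 * (t * norm d)" using 2 t by (intro mult_left_mono) auto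
    finally have "norm d * norm d \<le> (110 * R\<^sup>2 * t) * norm d" by (simp add: mult_ac)
    then have "norm d \<le> 110 * R\<^sup>2 * t" using t by (cases "norm d = 0") (auto simp: mult_le_cancel_right)
    then show ?thesis using 2 by (simp add: d_def)
  qed
  have "((\<lambda>t. dir_deriv v \<psi> (x + t *\<^sub>R v)) has_real_derivative dir_deriv v (dir_deriv v \<psi>) x) (at 0)"
    using smooth_line_deriv[OF smooth_dir_deriv[OF smooth_psi, of v], of x v 0] by simp
  then have "((\<lambda>t. dir_deriv v \<psi> (x + t *\<^sub>R v) - 110 * R\<^sup>2 * t) has_real_derivative
      dir_deriv v (dir_deriv v \<psi>) x - 110 * R\<^sup>2) (at 0)"
    by (auto intro!: derivative_eq_intros)
  from DERIV_pos_inc_right[OF this pos] obtain e where "e > 0" and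
    inc: "\<And>h. 0 < h \<Longrightarrow> h < e \<Longrightarrow> dir_deriv v \<psi> x < dir_deriv v \<psi> (x + h *\<^sub>R v) - 110 * R\<^sup>2 * h"
    by auto
  then show False using inc[of "e / 2"] step[of "e / 2"] by (simp add: psi_deriv inner_diff_left)
qed

text \<open>The barrier is \<open>(1 + \<delta>) (R\<^sup>2 + R s)\<close> with \<open>s = sqrt (R\<^sup>2 - |y|\<^sup>2)\<close>. Its concavity in \<open>|y|\<^sup>2\<close> reduces a maximum of \<open>U\<close> to the
situation of \<open>laplacian_at_max\<close> with slope \<open>c = (1 + \<delta>) R / (2 s)\<close>, and \<open>|y|\<^sup>2 = (R - s) (R + s)\<close>. The factor \<open>1 + \<delta>\<close> keeps
\<open>2 c - 1\<close> positive even where the gradient vanishes and \<open>s = R\<close>.\<close>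
lemma laplacian_le_2_R_sq:
  assumes strict: "\<And>y. y \<in> K \<Longrightarrow> norm y < R"
  shows "laplacian \<psi> x \<le> 2 * R\<^sup>2"
proof -
  have R: "R > 0" using strict[OF grad_in_K, of x] by (smt (verit) norm_ge_zero)
  define CB where "CB = real CARD('n) * (110 * R\<^sup>2)"
  have bnd: "laplacian \<psi> z \<le> CB" for z
  proof -
    have "laplacian \<psi> z \<le> (\<Sum>i\<in>(UNIV::'n set). 110 * R\<^sup>2)"
      unfolding laplacian_eq_trace by (intro sum_mono second_derivative_bounded R) simp
    then show ?thesis by (simp add: CB_def)
  qed
  define r where "r z = grad \<psi> z \<bullet> grad \<psi> z" for z
  define s where "s z = sqrt (R\<^sup>2 - r z)" for z
  have r: "0 \<le> r z" "r z < R\<^sup>2" for z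
    using power_strict_mono[OF strict[OF grad_in_K], of z 2] by (simp_all add: r_def power2_norm_eq_inner)
  have s: "s z > 0" "(s z)\<^sup>2 = R\<^sup>2 - r z" for z using r(2)[of z] by (simp_all add: s_def less_imp_le)
  have sR: "s z \<le> R" for z
    by (rule power2_le_imp_le) (use r(1)[of z] R s(2)[of z] in auto)
  define C where "C = real CARD('n) + R * M"
  have C: "C \<ge> 0" using R M_nonneg by (simp add: C_def)
  obtain L where L: "\<And>z. L \<le> \<psi> z" using psi_bounded_below by blast
  have main: "laplacian \<psi> x \<le> (1 + \<delta>) * (2 * R\<^sup>2) + \<epsilon> * (\<psi> x + C / \<delta> - L)" if dl: "\<delta> > 0" and ep: "\<epsilon> > 0" for \<delta> \<epsilon>
  proof -
    define U where "U z = laplacian \<psi> z - (1 + \<delta>) * (R\<^sup>2 + R * s z) - \<epsilon> * \<psi> z" for z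
    have "continuous_on UNIV U"
      unfolding U_def s_def r_def
      by (intro continuous_intros smooth_continuous smooth_laplacian smooth_psi continuous_on_grad)
    moreover have "bounded {z. U x \<le> U z}"
    proof (rule bounded_subset[OF bounded_sublevel])
      have "\<psi> z \<le> (CB - U x) / \<epsilon>" if "U x \<le> U z" for z
      proof -
        have "0 \<le> (1 + \<delta>) * (R\<^sup>2 + R * s z)" using dl R s(1)[of z] by simp
        then have "\<epsilon> * \<psi> z \<le> CB - U x" using that bnd[of z] unfolding U_def[of z] by linarith
        then show ?thesis using ep by (simp add: field_simps)
      qed
      then show "{z. U x \<le> U z} \<subseteq> {z. \<psi> z \<le> (CB - U x) / \<epsilon>}" by blast
    qed
    ultimately obtain z0 where z0: "\<And>z. U z \<le> U z0" using continuous_attains_global_max by blast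
    define c where "c = (1 + \<delta>) * R / (2 * s z0)"
    have c: "c * (2 * s z0) = (1 + \<delta>) * R" using s(1)[of z0] by (simp add: c_def)
    have c0: "c \<ge> 0" using dl R s(1)[of z0] by (simp add: c_def)
    have "laplacian \<psi> z + c * (grad \<psi> z \<bullet> grad \<psi> z) - \<epsilon> * \<psi> z
        \<le> laplacian \<psi> z0 + c * (grad \<psi> z0 \<bullet> grad \<psi> z0) - \<epsilon> * \<psi> z0" for z
    proof -
      have "0 \<le> (s z - s z0)\<^sup>2" by simp
      then have "(s z - s z0) * (2 * s z0) \<le> r z0 - r z"
        using s(2)[of z] s(2)[of z0] by (simp add: power2_eq_square algebra_simps)
      then have "c * ((s z - s z0) * (2 * s z0)) \<le> c * (r z0 - r z)" using c0 by (rule mult_left_mono)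
      then have "(1 + \<delta>) * R * (s z - s z0) \<le> c * (r z0 - r z)"
        unfolding c[symmetric] by (simp add: mult_ac)
      then show ?thesis using z0[of z] by (simp add: U_def r_def[symmetric] algebra_simps)
    qed
    from laplacian_at_max[OF this less_imp_le[OF ep]]
    have "(2 * c - 1) * laplacian \<psi> z0 \<le> 2 * c * r z0 + \<epsilon> * C" by (simp add: r_def C_def)
    then have "s z0 * ((2 * c - 1) * laplacian \<psi> z0) \<le> s z0 * (2 * c * r z0 + \<epsilon> * C)"
      using s(1)[of z0] by (intro mult_left_mono) auto
    then have 1: "((1 + \<delta>) * R - s z0) * laplacian \<psi> z0 \<le> (1 + \<delta>) * R * r z0 + s z0 * (\<epsilon> * C)"
      unfolding c[symmetric] by (simp add: algebra_simps)
    define w where "w = (1 + \<delta>) * R - s z0"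
    have w: "\<delta> * R \<le> w" using sR[of z0] by (simp add: w_def algebra_simps)
    then have w0: "w > 0" using dl R by (smt (verit) mult_pos_pos)
    have "r z0 = (R - s z0) * (R + s z0)" using s(2)[of z0] by (simp add: power2_eq_square algebra_simps)
    also have "\<dots> \<le> w * (R + s z0)"
      using dl R s(1)[of z0] by (intro mult_right_mono) (auto simp: w_def algebra_simps)
    finally have "(1 + \<delta>) * R * r z0 \<le> (1 + \<delta>) * R * (w * (R + s z0))" using dl R by (intro mult_left_mono) auto
    moreover have "s z0 * (\<epsilon> * C) \<le> (w / \<delta>) * (\<epsilon> * C)"
    proof (rule mult_right_mono)
      have "R \<le> w / \<delta>" using w dl by (simp add: field_simps)
      then show "s z0 \<le> w / \<delta>" using sR[of z0] by linarith
    qed (use ep C in simp)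
    ultimately have "w * laplacian \<psi> z0 \<le> (1 + \<delta>) * R * (w * (R + s z0)) + (w / \<delta>) * (\<epsilon> * C)"
      using 1 unfolding w_def[symmetric] by linarith
    also have "\<dots> = w * ((1 + \<delta>) * (R\<^sup>2 + R * s z0) + \<epsilon> * (C / \<delta>))"
      by (simp add: power2_eq_square algebra_simps)
    finally have "laplacian \<psi> z0 \<le> (1 + \<delta>) * (R\<^sup>2 + R * s z0) + \<epsilon> * (C / \<delta>)"
      using w0 by (simp only: mult_le_cancel_left_pos)
    then have "U z0 \<le> \<epsilon> * (C / \<delta>) - \<epsilon> * L"
      using mult_left_mono[OF L[of z0] less_imp_le[OF ep]] by (simp add: U_def)
    then have "U x \<le> \<epsilon> * (C / \<delta>) - \<epsilon> * L" using z0[of x] by linarith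
    moreover have "(1 + \<delta>) * (R\<^sup>2 + R * s x) \<le> (1 + \<delta>) * (2 * R\<^sup>2)"
      using sR[of x] R dl by (intro mult_left_mono) (auto simp: power2_eq_square)
    ultimately show ?thesis by (simp add: U_def algebra_simps)
  qed
  have delta: "laplacian \<psi> x \<le> (1 + \<delta>) * (2 * R\<^sup>2)" if dl: "\<delta> > 0" for \<delta>
  proof (rule field_le_epsilon)
    fix e :: real assume e: "e > 0"
    define W where "W = \<psi> x + C / \<delta> - L"
    have "C / \<delta> \<ge> 0" using C dl by simp
    then have W: "W \<ge> 0" using L[of x] by (simp add: W_def)
    have "e / (W + 1) > 0" using e W by simp
    from main[OF dl this] have "laplacian \<psi> x \<le> (1 + \<delta>) * (2 * R\<^sup>2) + e / (W + 1) * W" by (simp add: W_def)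
    also have "e / (W + 1) * W \<le> e" using e W by (simp add: field_simps)
    finally show "laplacian \<psi> x \<le> (1 + \<delta>) * (2 * R\<^sup>2) + e" by simp
  qed
  show ?thesis
  proof (rule field_le_epsilon)
    fix e :: real assume e: "e > 0"
    then have "e / (2 * R\<^sup>2) > 0" using R by simp
    from delta[OF this] have "laplacian \<psi> x \<le> (1 + e / (2 * R\<^sup>2)) * (2 * R\<^sup>2)" .
    also have "\<dots> = 2 * R\<^sup>2 + e" using R by (simp add: distrib_right)
    finally show "laplacian \<psi> x \<le> 2 * R\<^sup>2 + e" .
  qed
qed

end

lemma norm_less_SUP_open:
  fixes K :: "'a::{real_normed_vector, perfect_space} set"
  assumes "open K" "bounded K" "y \<in> K"
  shows "norm y < (SUP y\<in>K. norm y)"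
proof -
  obtain r where r: "r > 0" "cball y r \<subseteq> K" using assms by (auto simp: open_contains_cball)
  obtain v :: 'a where v: "norm v = r" "norm y < norm (y + v)"
  proof (cases "y = 0")
    case True
    obtain u :: 'a where "norm u = r" using vector_choose_size[of r] r by auto
    then show thesis using that[of u] True r by simp
  next
    case False
    have "y + (r / norm y) *\<^sub>R y = (1 + r / norm y) *\<^sub>R y" by (simp add: algebra_simps)
    then have "norm (y + (r / norm y) *\<^sub>R y) = (1 + r / norm y) * norm y" using r by simp
    also have "\<dots> = norm y + r" using False by (simp add: field_simps)
    finally show thesis using that[of "(r / norm y) *\<^sub>R y"] False r by simp
  qed
  have "y + v \<in> K" using r v by (auto simp: dist_norm)
  moreover have "bdd_above (norm ` K)" using assms by (simp add: bounded_imp_bdd_above bounded_norm_comp)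
  ultimately have "norm (y + v) \<le> (SUP y\<in>K. norm y)" by (intro cSUP_upper)
  with v show ?thesis by linarith
qed

theorem theorem1p1:
  fixes \<mu> :: "(real ^ 'n::finite) measure"
    and K :: "(real ^ 'n) set"
    and \<rho> \<psi> :: "real ^ 'n \<Rightarrow> real"
  assumes "log_concave_measure \<mu> K \<rho>"
    and "(LINT y|\<mu>. y) = 0"
    and "bounded K"
    and "smooth_on K \<rho>"
    and "\<And>is. bounded (iter_partial is \<rho> ` K)"
    and "smooth_on UNIV \<psi>"
    and "has_moment_measure \<psi> \<mu>"
  shows "laplacian \<psi> x \<le> 2 * (SUP y\<in>K. norm y)\<^sup>2"
proof -
  have diff: "\<rho> differentiable (at y)" if "y \<in> K" for y
    using assms(4) that unfolding smooth_on_def by (metis iter_partial_Nil)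
  have "\<exists>B. \<forall>y\<in>K. \<bar>partial_deriv i \<rho> y\<bar> \<le> B" for i
    using assms(5)[of "[i]"] by (auto simp: bounded_iff)
  then obtain B where B: "\<And>i y. y \<in> K \<Longrightarrow> \<bar>partial_deriv i \<rho> y\<bar> \<le> B i" by metis
  have strict: "norm y < (SUP y\<in>K. norm y)" if "y \<in> K" for y
    using assms(1,3) that by (intro norm_less_SUP_open) (auto simp: log_concave_measure_def)
  interpret moment_map_bounded_gradient \<mu> K \<rho> \<psi> "SUP y\<in>K. norm y" "\<Sum>i\<in>UNIV. B i"
  proof
    show "bounded (\<rho> ` K)" using assms(5)[of "[]"] by simp
    fix y assume y: "y \<in> K"
    show "norm y \<le> (SUP y\<in>K. norm y)" using strict[OF y] by simp
    have "norm (grad \<rho> y) \<le> (\<Sum>i\<in>UNIV. \<bar>grad \<rho> y $ i\<bar>)" by (rule norm_le_l1_cart)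
    also have "\<dots> \<le> (\<Sum>i\<in>UNIV. B i)"
      using B[OF y] diff[OF y] by (intro sum_mono) (simp add: grad_def)
    finally show "norm (grad \<rho> y) \<le> (\<Sum>i\<in>UNIV. B i)" .
  qed (use assms diff in auto)
  show ?thesis by (rule laplacian_le_2_R_sq) (rule strict)
qed

end
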